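(* Let $q>2$ be a prime power. Suppose there exists an $[[n,n-k-l,k+1;k-l]]_q$ MDS EAQECC constructed by the Hermitian construction from an $[n,k]_{q^2}$ GRS code with $l$-dimensional Hermitian hull, where $0\le2k\le n\le q^2$ and $0\le l\le k$. Then for any integers $0\le i\le\min\{l,\frac n2-k\}$ and $0\le s\le l-i$, there exists an $[[n,n-k-i-s,k+i+1;k+i-s]]_q$ MDS EAQECC.
   Context: Classical codes: for a linear code $\mathcal C\subseteq\mathbb F_{q^2}^n$, $\mathcal C^{\perp_H}=\{\bm x:\sum_i y_ix_i^q=0\ \forall\bm y\in\mathcal C\}$ and $\mathrm{Hull}_H(\mathcal C)=\mathcal C\cap\mathcal C^{\perp_H}$. An $[n,k]_{q^2}$ GRS code is a code $\{(v_1f(a_1),\dots,v_nf(a_n)):f\in\mathbb F_{q^2}[x],\deg f\le k-1\}$ with distinct $a_j\in\mathbb F_{q^2}$ and $v_j\in\mathbb F_{q^2}^*$. EAQECCs: a $q$-ary entanglement-assisted quantum error-correcting code $[[n,\kappa,d;c]]_q$ encodes $\kappa$ information qudits into $n$ channel qudits with the help of $c$ pre-shared pairs of maximally entangled qudits, with minimum distance $d$. Explicitly (standard definition): there is an isometry $U:(\mathbb C^q)^{\otimes\kappa}\otimes(\mathbb C^q)^{\otimes c}\to(\mathbb C^q)^{\otimes n}$ such that, with $|\Phi\rangle=q^{-1/2}\sum_{x}|x\rangle|x\rangle$, the code space $Q=\{(U\otimes I)(|\varphi\rangle\otimes|\Phi\rangle^{\otimes c})\}\subseteq(\mathbb C^q)^{\otimes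 n}\otimes(\mathbb C^q)^{\otimes c}$ (where $U$ acts on the information qudits and the sender's halves of the pairs) detects every error $E\otimes I$ with $E$ acting nontrivially on at most $d-1$ of the $n$ channel qudits, i.e. $P(E\otimes I)P\in\mathbb C P$ for the projector $P$ onto $Q$. MDS: an $[[n,\kappa,d;c]]_q$ EAQECC with $2d\le n+2$ is MDS if $\kappa=c+n-2d+2$ (equality in the bound $\kappa\le c+\max\{0,n-2d+2\}$). Hermitian construction (known result, referred to in the claim): if $\mathcal C$ is an $[n,k,d]_{q^2}$ linear code, $\mathcal C^{\perp_H}$ has minimum distance $d^{\perp_H}$, and $r=\dim\mathrm{Hull}_H(\mathcal C)$, then there exist EAQECCs with parameters $[[n,k-r,d;n-k-r]]_q$ and $[[n,n-k-r,d^{\perp_H};k-r]]_q$. *)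

theory Defs
  imports
    "HOL-Analysis.Analysis"
    "HOL-Computational_Algebra.Polynomial"
    "HOL-Number_Theory.Prime_Powers"
begin

section \<open>Linear codes over a finite field\<close>

definition hermitian_dual ::
  "nat \<Rightarrow> ('a::field ^ 'n::finite) set \<Rightarrow> ('a ^ 'n) set" where
  "hermitian_dual q C = {x. \<forall>y\<in>C. (\<Sum>i\<in>UNIV. y $ i * (x $ i) ^ q) = 0}"

definition hermitian_hull ::
  "nat \<Rightarrow> ('a::field ^ 'n::finite) set \<Rightarrow> ('a ^ 'n) set" where
  "hermitian_hull q C = C \<inter> hermitian_dual q C"

definition hamming_dist :: "'a ^ 'n::finite \<Rightarrow> 'a ^ 'n \<Rightarrow> nat" where
  "hamming_dist x y = card {i. x $ i \<noteq> y $ i}"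

text \<open>A relation rather than a function: a code with a single codeword has no minimum
  distance.\<close>

definition has_min_dist :: "('a ^ 'n::finite) set \<Rightarrow> nat \<Rightarrow> bool" where
  "has_min_dist C d \<longleftrightarrow>
     (\<exists>x\<in>C. \<exists>y\<in>C. x \<noteq> y \<and> hamming_dist x y = d) \<and>
     (\<forall>x\<in>C. \<forall>y\<in>C. x \<noteq> y \<longrightarrow> d \<le> hamming_dist x y)"

text \<open>The disjunct \<open>f = 0\<close> matters for \<open>k = 0\<close> only, because \<open>degree 0 = 0\<close>. The condition
  \<open>k \<le> CARD('n)\<close> makes \<open>k\<close> the dimension.\<close>

definition grs_code :: "nat \<Rightarrow> ('a::field ^ 'n::finite) set \<Rightarrow> bool" where
  "grs_code k C \<longleftrightarrow> k \<le> CARD('n) \<and>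
     (\<exists>a v :: 'a ^ 'n. inj (($) a) \<and> (\<forall>j. v $ j \<noteq> 0) \<and>
       C = {(\<chi> j. v $ j * poly f (a $ j)) | f. f = 0 \<or> degree f < k})"


section \<open>Finite-dimensional Hilbert spaces with a distinguished basis\<close>

text \<open>The space with orthonormal basis \<open>B\<close> consists of the functions \<open>'b \<Rightarrow> complex\<close> that vanish
  outside \<open>B\<close>. An operator is given by its matrix entries \<open>A row column\<close>; only the entries
  indexed by the relevant basis sets are meaningful.\<close>

type_synonym ('b, 'c) op = "'b \<Rightarrow> 'c \<Rightarrow> complex"

definition hspace :: "'b set \<Rightarrow> ('b \<Rightarrow> complex) set" where
  "hspace B = {\<psi>. \<forall>b. b \<notin> B \<longrightarrow> \<psi> b = 0}"

definition op_apply :: "'b set \<Rightarrow> 'c set \<Rightarrow> ('c, 'b) op \<Rightarrow> ('b \<Rightarrow> complex) \<Rightarrow> 'c \<Rightarrow> complex" where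
  "op_apply B B' A \<psi> = (\<lambda>b'. if b' \<in> B' then \<Sum>b\<in>B. A b' b * \<psi> b else 0)"

definition op_mult :: "'b set \<Rightarrow> ('a, 'b) op \<Rightarrow> ('b, 'c) op \<Rightarrow> ('a, 'c) op" where
  "op_mult B A A' = (\<lambda>x z. \<Sum>y\<in>B. A x y * A' y z)"

definition op_id :: "('b, 'b) op" where
  "op_id x y = (if x = y then 1 else 0)"

definition op_tensor :: "('a, 'b) op \<Rightarrow> ('c, 'd) op \<Rightarrow> ('a \<times> 'c, 'b \<times> 'd) op" where
  "op_tensor A A' = (\<lambda>(x, y) (x', y'). A x x' * A' y y')"

definition isometry :: "'b set \<Rightarrow> 'c set \<Rightarrow> ('c, 'b) op \<Rightarrow> bool" where
  "isometry B B' U \<longleftrightarrow>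
     (\<forall>x\<in>B. \<forall>y\<in>B. (\<Sum>b\<in>B'. cnj (U b x) * U b y) = op_id x y)"

definition is_projector :: "'b set \<Rightarrow> ('b \<Rightarrow> complex) set \<Rightarrow> ('b, 'b) op \<Rightarrow> bool" where
  "is_projector B Q P \<longleftrightarrow>
     (\<forall>x\<in>B. \<forall>y\<in>B. P x y = cnj (P y x)) \<and>
     (\<forall>x\<in>B. \<forall>y\<in>B. op_mult B P P x y = P x y) \<and>
     op_apply B B P ` hspace B = Q"


section \<open>Entanglement-assisted codes\<close>

text \<open>The computational basis of \<open>m\<close> qudits is the set of words of length \<open>m\<close>.\<close>

definition qwords :: "nat \<Rightarrow> nat \<Rightarrow> nat list set" where
  "qwords q m = {w. length w = m \<and> set w \<subseteq> {..<q}}"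

text \<open>Amplitudes of one maximally entangled pair, and of \<open>c\<close> pairs after all sender halves
  have been moved to the left and all receiver halves to the right.\<close>

definition ebit :: "nat \<Rightarrow> nat \<Rightarrow> nat \<Rightarrow> complex" where
  "ebit q x y = (if x = y then 1 / complex_of_real (sqrt (real q)) else 0)"

definition ebits :: "nat \<Rightarrow> nat \<Rightarrow> nat list \<Rightarrow> nat list \<Rightarrow> complex" where
  "ebits q c x y = (if x \<in> qwords q c \<and> y \<in> qwords q c then \<Prod>j<c. ebit q (x ! j) (y ! j) else 0)"

definition ea_code_space ::
  "nat \<Rightarrow> nat \<Rightarrow> nat \<Rightarrow> nat \<Rightarrow> (nat list, nat list \<times> nat list) op
     \<Rightarrow> (nat list \<times> nat list \<Rightarrow> complex) set" where
  "ea_code_space q n \<kappa> c U =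
     (\<lambda>\<phi>. op_apply ((qwords q \<kappa> \<times> qwords q c) \<times> qwords q c) (qwords q n \<times> qwords q c)
            (op_tensor U op_id) (\<lambda>((a, x), y). \<phi> a * ebits q c x y)) ` hspace (qwords q \<kappa>)"

text \<open>\<open>E\<close> is the tensor product of an arbitrary operator \<open>F\<close> on the qudits in \<open>S\<close> and the
  identity on the remaining qudits.\<close>

definition acts_on :: "nat \<Rightarrow> nat \<Rightarrow> nat set \<Rightarrow> (nat list, nat list) op \<Rightarrow> bool" where
  "acts_on q n S E \<longleftrightarrow>
     (\<exists>F. \<forall>w\<in>qwords q n. \<forall>w'\<in>qwords q n.
        E w w' = F (nths w S) (nths w' S) * op_id (nths w (- S)) (nths w' (- S)))"

definition detects :: "nat \<Rightarrow> nat \<Rightarrow> nat \<Rightarrow> nat \<Rightarrow> (nat list \<times> nat list \<Rightarrow> complex) set \<Rightarrow> bool" where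
  "detects q n c d Q \<longleftrightarrow>
     (let B = qwords q n \<times> qwords q c in
      \<exists>P. is_projector B Q P \<and>
        (\<forall>S E. S \<subseteq> {..<n} \<and> card S < d \<and> acts_on q n S E \<longrightarrow>
          (\<exists>z. \<forall>x\<in>B. \<forall>y\<in>B.
             op_mult B (op_mult B P (op_tensor E op_id)) P x y = z * P x y)))"

definition eaqecc ::
  "nat \<Rightarrow> nat \<Rightarrow> nat \<Rightarrow> nat \<Rightarrow> nat \<Rightarrow> (nat list \<times> nat list \<Rightarrow> complex) set \<Rightarrow> bool" where
  "eaqecc q n \<kappa> d c Q \<longleftrightarrow>
     (\<exists>U. isometry (qwords q \<kappa> \<times> qwords q c) (qwords q n) U \<and>
          Q = ea_code_space q n \<kappa> c U) \<and>
     detects q n c d Q"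

definition mds_eaqecc ::
  "nat \<Rightarrow> nat \<Rightarrow> nat \<Rightarrow> nat \<Rightarrow> nat \<Rightarrow> (nat list \<times> nat list \<Rightarrow> complex) set \<Rightarrow> bool" where
  "mds_eaqecc q n \<kappa> d c Q \<longleftrightarrow>
     eaqecc q n \<kappa> d c Q \<and> 2 * d \<le> n + 2 \<and> \<kappa> = c + (n + 2 - 2 * d)"

text \<open>The Hermitian construction is an existence result, stated at the level of parameters: this
  relates a linear code to the two quadruples that the result provides for it.\<close>

definition hermitian_construction ::
  "nat \<Rightarrow> ('a::field ^ 'n::finite) set \<Rightarrow> nat \<Rightarrow> nat \<Rightarrow> nat \<Rightarrow> nat \<Rightarrow> bool" where
  "hermitian_construction q C n \<kappa> d c \<longleftrightarrow>
     vec.subspace C \<and> n = CARD('n) \<and>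
     (let k = vec.dim C; r = vec.dim (hermitian_hull q C) in
       (has_min_dist C d \<and> \<kappa> = k - r \<and> c = n - k - r) \<or>
       (has_min_dist (hermitian_dual q C) d \<and> \<kappa> = n - k - r \<and> c = k - r))"

end

theory Submission
  imports Defs "HOL-Library.Product_Plus" "HOL-Library.Function_Algebras"
begin

text \<open>Raising the degree bound of the GRS code by one costs at most one dimension of the hull, since the
  hull vectors orthogonal to the new generator stay in the hull. Scaling one coordinate \<open>j\<close> by \<open>\<alpha>\<close>
  with \<open>\<alpha> ^ (q + 1) \<noteq> 1\<close>, which exists because \<open>q > 2\<close>, replaces the hull by its vectors that vanish
  at \<open>j\<close>. So there is a GRS code of dimension \<open>K = k + i\<close> whose hull has dimension exactly \<open>s\<close>.

  Modulo its hull such a code has a basis \<open>e\<close> of \<open>c = K - s\<close> vectors that is orthonormal for the negated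
  Hermitian form. Appending the entries \<open>herm x (e j)\<close> makes the code self-orthogonal of length
  \<open>n + c\<close>, so it labels commuting Weyl operators, which can be rescaled by phases to form a group;
  averaging over this group gives the projector onto the code space. A Weyl operator that does not
  commute with some group element is mapped to zero by compression to the code space. Nonzero errors
  on at most \<open>K\<close> channel qudits are of this kind because the code is MDS; nonzero errors on the
  receiver's qudits are of this kind because of the vectors \<open>e\<close>, and this makes the receiver's
  reduced state maximally mixed, which is what the encoder needs to be an isometry.\<close>

section \<open>Quadratic extensions of finite fields\<close>

text \<open>The predicate \<open>hermitian_construction\<close> relates parameters only, so quantum
  codes for the modified GRS codes have to be built outright. The bridge is the splitting of each
  entry over the \<open>Fq\<close>-basis 1, \<open>w\<close> into a shift label and a phase label.
  Whether two Weyl operators commute then depends only on the \<open>w\<close>-coordinate of the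
  Hermitian product of their labels. Orthogonality thus gives commuting operators; conversely, a
  nonzero product yields noncommuting ones because the code is closed under all scalars of the large
  field.

  The phases come from divisibility of the circle group, not from a formula: for a symmetric
  bicharacter \<open>b\<close> the usual choice, \<open>b\<close> of x and x/2, fails in
  characteristic 2.

  The parameters come from counting. There are q^(2K) labels in dimension q^(n+c), so the projector
  has trace q^(n+c-2K), and K = s + c turns the exponent into n - K - s. The bound i <= n/2 - k says
  2K <= n, which is the MDS condition 2d <= n + 2 for d = K + 1.\<close>

lemma card_le_fibres:
  assumes "finite A" "\<And>y. y \<in> f ` A \<Longrightarrow> card {x\<in>A. f x = y} \<le> m"
  shows "card A \<le> card (f ` A) * m"
proof -
  have "card A = (\<Sum>y\<in>f ` A. card {x\<in>A. f x = y})"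
    using sum.image_gen[OF assms(1), of "\<lambda>_. 1::nat" f] by simp
  also have "\<dots> \<le> (\<Sum>y\<in>f ` A. m)" by (intro sum_mono assms(2))
  finally show ?thesis by simp
qed

text \<open>Multiplication by a nonzero \<open>x\<close> permutes the nonzero elements, so comparing
  their product before and after cancels to a power of \<open>x\<close> equal to 1.\<close>

lemma power_card_eq_self:
  fixes x :: "'a::{field,finite}"
  shows "x ^ CARD('a) = x"
proof (cases "x = 0")
  case False
  have "(\<Prod>y\<in>-{0}. y) = (\<Prod>y\<in>-{0}. x * y)"
    by (rule prod.reindex_bij_witness[of _ "\<lambda>y. x * y" "\<lambda>y. y / x"]) (use False in auto)
  also have "\<dots> = x ^ (CARD('a) - 1) * (\<Prod>y\<in>-{0}. y)"
    by (simp add: prod.distrib card_Diff_singleton Compl_eq_Diff_UNIV)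
  finally have "x ^ (CARD('a) - 1) = 1" by simp
  then show ?thesis
    by (metis mult.right_neutral power_minus_mult zero_less_card_finite mult.commute)
qed auto

text \<open>Translation by 1 permutes the field, so adding 1 to every summand does not change the
  sum of all elements.\<close>

lemma of_nat_card_eq_0: "of_nat CARD('a) = (0 :: 'a::{field,finite})"
proof -
  have "(\<Sum>x\<in>UNIV. x + 1) = (\<Sum>x\<in>UNIV. x :: 'a)"
    by (rule sum.reindex_bij_witness[of _ "\<lambda>x. x - 1" "\<lambda>x. x + 1"]) auto
  then show ?thesis by (simp add: sum.distrib)
qed

locale quadratic_extension =
  fixes q :: nat and ty :: "'a::{field,finite} itself"
  assumes primepow_q: "primepow q" and card_UNIV_eq: "CARD('a) = q ^ 2"
begin

lemma q_gt_1: "q > 1"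
  using primepow_gt_Suc_0[OF primepow_q] by simp

text \<open>The characteristic divides the order q^2 of the field, hence is the prime below
  \<open>q\<close>. This makes the map from x to x^q additive.\<close>

lemma q_eq_power_CHAR: "\<exists>r. q = CHAR('a) ^ r"
  and prime_CHAR: "prime CHAR('a)"
proof -
  have "CHAR('a) > 0"
    using finite_imp_CHAR_pos[where 'a='a] by simp
  then show p: "prime CHAR('a)" by (rule prime_CHAR_semidom)
  obtain p r where pr: "prime p" "q = p ^ r"
    using primepow_q by (auto simp: primepow_def)
  have "CHAR('a) dvd CARD('a)"
    using of_nat_card_eq_0[where 'a='a] by (simp add: of_nat_eq_0_iff_char_dvd)
  then have "CHAR('a) dvd p"
    using p pr card_UNIV_eq by (metis prime_dvd_power)
  then have "CHAR('a) = p"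
    using p pr(1) primes_dvd_imp_eq by blast
  then show "\<exists>r. q = CHAR('a) ^ r" using pr by blast
qed

lemma conj_add: "(x + y :: 'a) ^ q = x ^ q + y ^ q"
  using q_eq_power_CHAR prime_CHAR freshmans_dream' by metis

lemma conj_zero [simp]: "(0::'a) ^ q = 0"
  using q_gt_1 by simp

lemma conj_minus: "(- x :: 'a) ^ q = - (x ^ q)"
  using conj_add[of x "- x"] by (simp add: eq_neg_iff_add_eq_0 add.commute)

lemma conj_diff: "(x - y :: 'a) ^ q = x ^ q - y ^ q"
  using conj_add[of x "- y"] by (simp add: conj_minus)

lemma conj_sum: "(\<Sum>i\<in>I. f i :: 'a) ^ q = (\<Sum>i\<in>I. f i ^ q)"
  by (induction I rule: infinite_finite_induct) (auto simp: conj_add)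

lemma conj_conj [simp]: "((x::'a) ^ q) ^ q = x"
  using power_card_eq_self[of x] by (simp add: card_UNIV_eq power_mult[symmetric] power2_eq_square)

lemma conj_eq_0 [simp]: "(x::'a) ^ q = 0 \<longleftrightarrow> x = 0"
  using q_gt_1 by simp

section \<open>The subfield of order q, coordinates over it, and the norm\<close>

definition Fq :: "'a set" where "Fq = {x. x ^ q = x}"

lemma Fq_closed [intro]:
  "0 \<in> Fq" "1 \<in> Fq" "x \<in> Fq \<Longrightarrow> y \<in> Fq \<Longrightarrow> x + y \<in> Fq" "x \<in> Fq \<Longrightarrow> - x \<in> Fq"
  "x \<in> Fq \<Longrightarrow> y \<in> Fq \<Longrightarrow> x - y \<in> Fq" "x \<in> Fq \<Longrightarrow> y \<in> Fq \<Longrightarrow> x * y \<in> Fq"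
  "x \<in> Fq \<Longrightarrow> inverse x \<in> Fq"
  by (auto simp: Fq_def conj_add conj_minus conj_diff power_mult_distrib power_inverse)

lemma card_power_roots_le:
  assumes "m > 0" shows "card {x::'a. x ^ m = t} \<le> m"
proof -
  have "degree (monom 1 m - [:t:]) = m"
    using assms by (subst diff_conv_add_uminus, subst degree_add_eq_left) (auto simp: degree_monom_eq)
  moreover from this have "monom 1 m - [:t:] \<noteq> 0" using assms by (metis degree_0 less_irrefl)
  ultimately show ?thesis
    using card_poly_roots_bound[of "monom 1 m - [:t:]"] by (simp add: poly_monom)
qed

lemma card_Fq_le: "card Fq \<le> q"
proof -
  let ?p = "monom 1 q - [:0, 1::'a:]"
  have "degree ?p = q"
    using q_gt_1 by (subst diff_conv_add_uminus, subst degree_add_eq_left) (auto simp: degree_monom_eq)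
  moreover from this have "?p \<noteq> 0" using q_gt_1 by (metis degree_0 not_one_less_zero)
  ultimately show ?thesis
    using card_poly_roots_bound[of ?p] by (simp add: poly_monom Fq_def)
qed

definition w :: 'a where "w = (SOME x. x \<notin> Fq)"

lemma w_notin: "w \<notin> Fq"
proof -
  have "q < q ^ 2" using q_gt_1 by (simp add: power2_eq_square)
  then have "Fq \<noteq> UNIV" using card_Fq_le card_UNIV_eq by auto
  then show ?thesis unfolding w_def by (metis UNIV_eq_I someI_ex)
qed

lemma conj_w_neq: "w ^ q \<noteq> w"
  using w_notin by (auto simp: Fq_def)

text \<open>Solution for b of the system z = a + b w, z^q = a + b w^q with a and b in
  \<open>Fq\<close>.\<close>

definition snd_coord :: "'a \<Rightarrow> 'a" where "snd_coord z = (z - z ^ q) / (w - w ^ q)"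
definition fst_coord :: "'a \<Rightarrow> 'a" where "fst_coord z = z - snd_coord z * w"

lemma snd_coord_Fq: "snd_coord z \<in> Fq"
proof -
  have "snd_coord z ^ q = (z ^ q - z) / (w ^ q - w)"
    by (simp add: snd_coord_def power_divide conj_diff)
  also have "\<dots> = snd_coord z"
    by (metis snd_coord_def minus_diff_eq minus_divide_divide)
  finally show ?thesis by (simp add: Fq_def)
qed

lemma fst_coord_Fq: "fst_coord z \<in> Fq"
proof -
  have "snd_coord z * (w - w ^ q) = z - z ^ q"
    using conj_w_neq by (simp add: snd_coord_def)
  moreover have "snd_coord z ^ q = snd_coord z" using snd_coord_Fq by (simp add: Fq_def)
  ultimately show ?thesis
    by (simp add: Fq_def fst_coord_def conj_diff power_mult_distrib algebra_simps)
qed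

lemma coords: "fst_coord z + snd_coord z * w = z"
  by (simp add: fst_coord_def)

lemma coords_unique:
  assumes "a \<in> Fq" "b \<in> Fq"
  shows "snd_coord (a + b * w) = b" "fst_coord (a + b * w) = a"
proof -
  have "a + b * w - (a + b * w) ^ q = b * (w - w ^ q)"
    using assms by (simp add: conj_add power_mult_distrib Fq_def algebra_simps)
  then show "snd_coord (a + b * w) = b"
    using conj_w_neq by (simp add: snd_coord_def)
  then show "fst_coord (a + b * w) = a" by (simp add: fst_coord_def)
qed

lemma coords_inj: "fst_coord x = fst_coord y \<Longrightarrow> snd_coord x = snd_coord y \<Longrightarrow> x = y"
  by (metis coords)

lemma snd_coord_add: "snd_coord (x + y) = snd_coord x + snd_coord y"
  by (simp add: snd_coord_def conj_add add_divide_distrib[symmetric] algebra_simps)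

lemma fst_coord_add: "fst_coord (x + y) = fst_coord x + fst_coord y"
  by (simp add: fst_coord_def snd_coord_add algebra_simps)

lemma coords_zero [simp]: "snd_coord 0 = 0" "fst_coord 0 = 0"
  by (simp_all add: snd_coord_def fst_coord_def)

lemma snd_coord_minus: "snd_coord (- x) = - snd_coord x"
  using snd_coord_add[of x "- x"] by (simp add: eq_neg_iff_add_eq_0 add.commute)

lemma fst_coord_minus: "fst_coord (- x) = - fst_coord x"
  using fst_coord_add[of x "- x"] by (simp add: eq_neg_iff_add_eq_0 add.commute)

lemma card_Fq: "card Fq = q"
proof -
  have "bij_betw (\<lambda>z. (fst_coord z, snd_coord z)) UNIV (Fq \<times> Fq)"
    by (rule bij_betwI[where g = "\<lambda>(a, b). a + b * w"])
      (auto simp: fst_coord_Fq snd_coord_Fq coords coords_unique)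
  then have "q ^ 2 = card Fq ^ 2"
    using bij_betw_same_card card_UNIV_eq by (fastforce simp: power2_eq_square card_cartesian_product)
  then show ?thesis by simp
qed

text \<open>The left side is the symplectic form that governs commutation of Weyl operators.
  Expanding the right side in coordinates leaves their determinant times w - w^q.\<close>

lemma symplectic_hermitian:
  "fst_coord y * snd_coord x - fst_coord x * snd_coord y
    = (x * y ^ q - x ^ q * y) / (w - w ^ q)"
proof -
  let ?a = "fst_coord x" and ?b = "snd_coord x" and ?c = "fst_coord y" and ?d = "snd_coord y"
  have F: "?a ^ q = ?a" "?b ^ q = ?b" "?c ^ q = ?c" "?d ^ q = ?d"
    using fst_coord_Fq snd_coord_Fq by (auto simp: Fq_def)
  have "x ^ q = ?a + ?b * w ^ q" "y ^ q = ?c + ?d * w ^ q"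
    by (metis F conj_add coords power_mult_distrib)+
  then have "x * y ^ q - x ^ q * y
    = (?a + ?b * w) * (?c + ?d * w ^ q) - (?a + ?b * w ^ q) * (?c + ?d * w)"
    by (simp add: coords)
  also have "\<dots> = (?c * ?b - ?a * ?d) * (w - w ^ q)" by (simp add: algebra_simps)
  finally show ?thesis using conj_w_neq by simp
qed

text \<open>A fibre of the norm has at most q + 1 elements, so the q^2 - 1 nonzero elements have at
  least q - 1 norms, and \<open>Fq\<close> has only q - 1 nonzero elements.\<close>

lemma norm_surj:
  assumes "t \<in> Fq" shows "\<exists>x. x ^ (q + 1) = t"
proof (cases "t = 0")
  case False
  let ?N = "\<lambda>x::'a. x ^ (q + 1)"
  have "card (-{0::'a}) \<le> card (?N ` (-{0})) * (q + 1)"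
  proof (rule card_le_fibres)
    fix y show "card {x \<in> -{0}. ?N x = y} \<le> q + 1"
      by (rule order_trans[OF card_mono card_power_roots_le[of "q + 1" y]]) auto
  qed auto
  moreover have "card (-{0::'a}) = (q - 1) * (q + 1)"
    using q_gt_1 by (simp add: Compl_eq_Diff_UNIV card_Diff_singleton card_UNIV_eq power2_eq_square
        algebra_simps)
  ultimately have "q - 1 \<le> card (?N ` (-{0}))"
    by (metis add_gr_0 mult_le_cancel2 zero_less_one)
  moreover have "?N ` (-{0}) \<subseteq> Fq - {0}"
    by (auto simp: Fq_def power_mult_distrib mult.commute)
  moreover have "card (Fq - {0}) = q - 1"
    using Fq_closed(1) by (simp add: card_Diff_singleton card_Fq)
  ultimately have "?N ` (-{0}) = Fq - {0}"
    by (intro card_seteq) auto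
  then show ?thesis using assms False by (metis Diff_iff empty_iff image_iff insert_iff)
qed (use q_gt_1 in auto)

text \<open>For q > 2 the subfield contains an element other than 0 and 1, and it is a norm. For q =
  2 every nonzero norm would be 1.\<close>

lemma exists_norm_neq_1:
  assumes "q > 2" shows "\<exists>x::'a. x \<noteq> 0 \<and> x ^ (q + 1) \<noteq> 1"
proof -
  have "card (Fq - {0, 1}) = q - 2"
    using Fq_closed(1,2) by (subst card_Diff_subset) (auto simp: card_Fq)
  then obtain t where "t \<in> Fq" "t \<noteq> 0" "t \<noteq> 1"
    using assms by (metis Diff_iff card.empty all_not_in_conv insertI1 insertI2 zero_less_diff less_irrefl)
  then show ?thesis using norm_surj by (metis power_0_Suc Suc_eq_plus1)
qed

end

section \<open>Trivialising symmetric bicharacters on finite abelian groups\<close>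

text \<open>Subgroups are sets because the groups needed later, such as words of bounded length, are
  proper subsets of a function type.\<close>

definition subgrp :: "'g::ab_group_add set \<Rightarrow> bool" where
  "subgrp H \<longleftrightarrow> 0 \<in> H \<and> (\<forall>x\<in>H. \<forall>y\<in>H. x - y \<in> H)"

lemma subgrp_closed:
  assumes "subgrp H"
  shows "0 \<in> H" "x \<in> H \<Longrightarrow> y \<in> H \<Longrightarrow> x - y \<in> H" "x \<in> H \<Longrightarrow> - x \<in> H"
    "x \<in> H \<Longrightarrow> y \<in> H \<Longrightarrow> x + y \<in> H"
proof -
  show *: "0 \<in> H" "\<And>x y. x \<in> H \<Longrightarrow> y \<in> H \<Longrightarrow> x - y \<in> H"
    using assms by (auto simp: subgrp_def)
  show minus: "\<And>x. x \<in> H \<Longrightarrow> - x \<in> H" using *(2)[of 0] *(1) by simp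
  show "x \<in> H \<Longrightarrow> y \<in> H \<Longrightarrow> x + y \<in> H" using *(2)[of x "- y"] minus by simp
qed

primrec nmul :: "nat \<Rightarrow> 'g::ab_group_add \<Rightarrow> 'g" where
  "nmul 0 g = 0"
| "nmul (Suc j) g = g + nmul j g"

lemma nmul_add: "nmul (i + j) g = nmul i g + nmul j g"
  by (induction i) (auto simp: algebra_simps)

lemma nmul_closed: "subgrp H \<Longrightarrow> g \<in> H \<Longrightarrow> nmul j g \<in> H"
  by (induction j) (auto simp: subgrp_closed)

lemma nmul_mult_closed: "subgrp H \<Longrightarrow> nmul m g \<in> H \<Longrightarrow> nmul (m * j) g \<in> H"
  by (induction j) (auto simp: subgrp_closed nmul_add)

lemma nmul_finite:
  assumes "finite D" "subgrp D" "g \<in> D"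
  shows "\<exists>m>0. nmul m g = 0"
proof -
  have "range (\<lambda>j. nmul j g) \<subseteq> D" using nmul_closed[OF assms(2,3)] by auto
  then have "\<not> inj (\<lambda>j. nmul j g)"
    using assms(1) finite_subset finite_imageD by blast
  then obtain i j where "i < j" "nmul i g = nmul j g"
    by (metis injI linorder_neqE_nat)
  then have "nmul (j - i) g = 0"
    using nmul_add[of i "j - i" g] by simp
  then show ?thesis using \<open>i < j\<close> by (intro exI[of _ "j - i"]) auto
qed

text \<open>Says that the 2-cocycle \<open>b\<close> is a coboundary with unit complex values. If
  operators multiply up to the factor \<open>b\<close>, rescaling them by \<open>lam\<close> makes
  the product exact.\<close>

definition trivialises ::
  "('g::ab_group_add \<Rightarrow> 'g \<Rightarrow> complex) \<Rightarrow> 'g set \<Rightarrow> ('g \<Rightarrow> complex) \<Rightarrow> bool" where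
  "trivialises b H lam \<longleftrightarrow>
     (\<forall>x\<in>H. norm (lam x) = 1) \<and> (\<forall>x\<in>H. \<forall>y\<in>H. lam (x + y) = lam x * lam y * b x y)"

text \<open>Additivity in the second argument follows from symmetry.\<close>

definition sym_bichar :: "('g::ab_group_add \<Rightarrow> 'g \<Rightarrow> complex) \<Rightarrow> 'g set \<Rightarrow> bool" where
  "sym_bichar b D \<longleftrightarrow>
     (\<forall>x\<in>D. \<forall>y\<in>D. norm (b x y) = 1 \<and> b x y = b y x) \<and>
     (\<forall>x\<in>D. \<forall>y\<in>D. \<forall>z\<in>D. b (x + y) z = b x z * b y z)"

lemma sym_bichar_nmul:
  assumes "sym_bichar b D" "subgrp D" "x \<in> D" "y \<in> D"
  shows "b (nmul j x) y = b x y ^ j"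
proof (induction j)
  case 0
  have "norm (b 0 y) = 1"
    using assms subgrp_closed(1)[OF assms(2)] by (auto simp: sym_bichar_def)
  moreover have "b (0 + 0) y = b 0 y * b 0 y"
    using assms subgrp_closed(1)[OF assms(2)] unfolding sym_bichar_def by blast
  ultimately show ?case by fastforce
next
  case (Suc j)
  then show ?case using assms nmul_closed[OF assms(2,3)] by (auto simp: sym_bichar_def)
qed

text \<open>Adjoining \<open>g\<close> leaves one free value, that at \<open>g\<close>. Its only
  constraint comes from the least positive multiple of \<open>g\<close> lying in \<open>H\<close>.
  The value stays a parameter because the character constructed below needs a prescribed
  one.\<close>

lemma trivialise_extend:
  fixes H D :: "'g::ab_group_add set"
  assumes D: "subgrp D" and H: "subgrp H" "H \<subseteq> D" and g: "g \<in> D"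
    and b: "sym_bichar b D" and lam: "trivialises b H lam"
    and m: "m > 0" "nmul m g \<in> H" "\<And>j. 0 < j \<Longrightarrow> j < m \<Longrightarrow> nmul j g \<notin> H"
    and \<mu>: "norm \<mu> = 1" "\<mu> ^ m * b g g ^ (m choose 2) = lam (nmul m g)"
  shows "\<exists>H' lam'. subgrp H' \<and> H \<subseteq> H' \<and> g \<in> H' \<and> H' \<subseteq> D \<and> trivialises b H' lam' \<and>
           lam' g = \<mu> \<and> (\<forall>h\<in>H. lam' h = lam h)"
proof -
  \<comment> \<open>The values forced by the law: expanding the j-fold multiple of \<open>g\<close>
    collects 0 + 1 + ... + (j - 1) factors \<open>b g g\<close>, whence the binomial
    coefficient.\<close>
  define f where "f j = \<mu> ^ j * b g g ^ (j choose 2)" for j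
  define L where "L h j = lam h * b h g ^ j * f j" for h j
  have f_add: "f (i + j) = f i * f j * b g g ^ (i * j)" for i j
  proof -
    have "(i + j) choose 2 = (i choose 2) + (j choose 2) + i * j"
      by (induction j) (auto simp: numeral_2_eq_2)
    then show ?thesis by (simp add: f_def power_add)
  qed
  have lam_mult: "lam (x + y) = lam x * lam y * b x y" if "x \<in> H" "y \<in> H" for x y
    using lam that by (auto simp: trivialises_def)
  have b_add: "b (x + y) z = b x z * b y z" if "x \<in> D" "y \<in> D" "z \<in> D" for x y z
    using b that by (auto simp: sym_bichar_def)
  have b_sym: "b x y = b y x" if "x \<in> D" "y \<in> D" for x y
    using b that by (auto simp: sym_bichar_def)
  have b_norm: "norm (b x y) = 1" if "x \<in> D" "y \<in> D" for x y
    using b that by (auto simp: sym_bichar_def)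
  have b_nmul: "b (nmul j x) y = b x y ^ j" if "x \<in> D" "y \<in> D" for x y j
    using sym_bichar_nmul[OF b D that] .
  have nD: "nmul j g \<in> D" for j using nmul_closed[OF D g] .
  \<comment> \<open>Well-definedness reduces to this shift: two representations of one element
    differ by a multiple of \<open>m\<close> in the exponent.\<close>
  have L_shift: "L h (m + j) = L (h + nmul m g) j" if "h \<in> H" for h j
  proof -
    have hD: "h \<in> D" using that H by auto
    have "L (h + nmul m g) j
        = lam h * f m * b h (nmul m g) * (b h g * b g g ^ m) ^ j * f j"
      using that hD m(2) \<mu>(2) g nD by (simp add: L_def lam_mult b_add b_nmul f_def)
    also have "b h (nmul m g) = b h g ^ m"
      using b_sym[OF hD nD] b_nmul[OF g hD] b_sym[OF g hD] by simp
    also have "lam h * f m * b h g ^ m * (b h g * b g g ^ m) ^ j * f j = L h (m + j)"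
      by (simp add: L_def f_add power_add power_mult_distrib power_mult)
    finally show ?thesis by simp
  qed
  have L_shifts: "L h (m * t + j) = L (h + nmul (m * t) g) j" if "h \<in> H" for h t j
    using that
  proof (induction t arbitrary: h)
    case (Suc t)
    have "L h (m * Suc t + j) = L h (m + (m * t + j))" by (simp add: algebra_simps)
    also have "\<dots> = L (h + nmul m g + nmul (m * t) g) j"
      using Suc L_shift m(2) subgrp_closed[OF H(1)] by simp
    finally show ?case by (simp add: nmul_add algebra_simps)
  qed simp
  have dvd: "m dvd j" if "nmul j g \<in> H" for j
  proof -
    have "nmul (m * (j div m)) g + nmul (j mod m) g \<in> H"
      using that by (simp flip: nmul_add)
    moreover have "nmul (m * (j div m)) g \<in> H" using nmul_mult_closed[OF H(1) m(2)] .
    ultimately have "nmul (j mod m) g \<in> H"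
      using subgrp_closed(2)[OF H(1)] by (metis add_diff_cancel_left')
    then show ?thesis using m(1) m(3)[of "j mod m"] by (auto simp: mod_greater_zero_iff_not_dvd)
  qed
  have L_cong': "L h j = L h' j'" if "h \<in> H" "h' \<in> H" "h + nmul j g = h' + nmul j' g" "j' \<le> j"
    for h h' j j'
  proof -
    have e: "nmul j g = nmul (j - j') g + nmul j' g" using that(4) by (simp flip: nmul_add)
    then have e': "h' = h + nmul (j - j') g" using that(3) by (simp add: algebra_simps)
    then have "nmul (j - j') g \<in> H"
      using that subgrp_closed(2)[OF H(1)] by (metis add_diff_cancel_left')
    then obtain t where "j - j' = m * t" using dvd by auto
    then show ?thesis using L_shifts[OF that(1), of t j'] e' that(4) by (metis le_add_diff_inverse2)
  qed
  have L_cong: "L h j = L h' j'" if "h \<in> H" "h' \<in> H" "h + nmul j g = h' + nmul j' g" for h h' j j'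
    using L_cong'[of h h' j j'] L_cong'[of h' h j' j] that by (metis linear)
  define H' where "H' = {h + nmul j g |h j. h \<in> H}"
  \<comment> \<open>The choice is harmless, since \<open>L_cong\<close> gives every representation
    of \<open>x\<close> the same value.\<close>
  define lam' where "lam' x = (SOME c. \<exists>h j. h \<in> H \<and> x = h + nmul j g \<and> c = L h j)" for x
  have lam'_eq: "lam' (h + nmul j g) = L h j" if "h \<in> H" for h j
    unfolding lam'_def by (rule some_equality) (use that L_cong in metis)+
  have "subgrp H'"
    unfolding subgrp_def
  proof safe
    show "0 \<in> H'" unfolding H'_def using subgrp_closed(1)[OF H(1)] by (metis (mono_tags, lifting) add_0 mem_Collect_eq nmul.simps(1))
    fix x y assume "x \<in> H'" "y \<in> H'"
    then obtain h j h' j' where x: "x = h + nmul j g" "y = h' + nmul j' g" "h \<in> H" "h' \<in> H"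
      by (auto simp: H'_def)
    \<comment> \<open>Exponents are natural numbers, so -j' is replaced by m j' - j', and the
      surplus m j' is moved into \<open>H\<close>.\<close>
    have "nmul (m * j') g = nmul (m * j' - j') g + nmul j' g"
      using m(1) by (simp flip: nmul_add)
    then have "x - y = (h - h' - nmul (m * j') g) + nmul (j + (m * j' - j')) g"
      by (simp add: x nmul_add)
    then show "x - y \<in> H'"
      unfolding H'_def using subgrp_closed(2)[OF H(1)] x(3,4) nmul_mult_closed[OF H(1) m(2)]
      by blast
  qed
  moreover have "H \<subseteq> H'"
  proof
    fix h assume "h \<in> H" then show "h \<in> H'"
      unfolding H'_def by (metis (mono_tags, lifting) add.right_neutral mem_Collect_eq nmul.simps(1))
  qed
  moreover have g1: "g = 0 + nmul 1 g" by simp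
  then have "g \<in> H'" unfolding H'_def using subgrp_closed(1)[OF H(1)] by blast
  moreover have "H' \<subseteq> D"
    using H nD subgrp_closed(4)[OF D] by (auto simp: H'_def)
  moreover have "lam' g = \<mu>"
  proof -
    have "lam 0 = 1"
      using lam lam_mult[of 0 0] b_nmul[of g 0 0] subgrp_closed(1)[OF H(1)] subgrp_closed(1)[OF D] g
      by (auto simp: trivialises_def)
    moreover have "b 0 g = 1" using b_nmul[of g g 0] g by simp
    ultimately show ?thesis
      using lam'_eq[of 0 1] subgrp_closed(1)[OF H(1)] by (simp add: L_def f_def numeral_2_eq_2)
  qed
  moreover have "\<forall>h\<in>H. lam' h = lam h"
    using lam'_eq[of _ 0] by (simp add: L_def f_def numeral_2_eq_2)
  moreover have "trivialises b H' lam'"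
    unfolding trivialises_def
  proof (intro conjI ballI)
    fix x assume "x \<in> H'"
    then obtain h j where "x = h + nmul j g" "h \<in> H" by (auto simp: H'_def)
    then show "norm (lam' x) = 1"
      using lam H(2) \<mu>(1) g by (auto simp: lam'_eq L_def f_def norm_mult norm_power b_norm subset_iff trivialises_def)
  next
    fix x y assume "x \<in> H'" "y \<in> H'"
    then obtain h j h' j' where x: "x = h + nmul j g" "y = h' + nmul j' g" "h \<in> H" "h' \<in> H"
      by (auto simp: H'_def)
    have hD: "h \<in> D" "h' \<in> D" using x H(2) by auto
    have "b x (h' + nmul j' g) = b x h' * b x (nmul j' g)"
      using b_add b_sym hD nD subgrp_closed(4)[OF D] by (metis x(1))
    also have "b x h' = b h h' * b g h' ^ j"
      using hD nD g by (simp add: x(1) b_add b_nmul)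
    also have "b x (nmul j' g) = (b h g * b g g ^ j) ^ j'"
    proof -
      have "b x (nmul j' g) = b x g ^ j'"
        using b_sym b_nmul hD nD g subgrp_closed(4)[OF D] by (metis x(1))
      then show ?thesis using hD nD g by (simp add: x(1) b_add b_nmul)
    qed
    finally have bxy: "b x y = b h h' * b h' g ^ j * b h g ^ j' * b g g ^ (j * j')"
      using b_sym[OF g hD(2)] x(2) by (simp add: power_mult_distrib power_mult)
    have "x + y = (h + h') + nmul (j + j') g" by (simp add: x nmul_add)
    then have "lam' (x + y) = L (h + h') (j + j')"
      using lam'_eq subgrp_closed(4)[OF H(1)] x(3,4) by metis
    also have "\<dots> = L h j * L h' j' * b x y"
      using x(3,4) hD g by (simp add: L_def bxy lam_mult b_add f_add power_add power_mult_distrib)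
    finally show "lam' (x + y) = lam' x * lam' y * b x y"
      using lam'_eq x by simp
  qed
  ultimately show ?thesis by blast
qed

lemma unit_root_exists:
  assumes "norm (z::complex) = 1" "m > 0"
  shows "\<exists>\<mu>. norm \<mu> = 1 \<and> \<mu> ^ m = z"
proof (intro exI conjI)
  show "norm (cis (Arg z / m)) = 1" by simp
  have "cis (Arg z / m) ^ m = cis (Arg z)"
    using assms(2) by (subst Complex.DeMoivre) simp
  also have "\<dots> = z" using assms(1) by (metis norm_zero cis_Arg sgn_div_norm div_by_1 inverse_1 scaleR_one zero_neq_one)
  finally show "cis (Arg z / m) ^ m = z" .
qed

lemma least_multiple:
  assumes "finite D" "subgrp D" "subgrp H" "g \<in> D"
  shows "\<exists>m>0. nmul m g \<in> H \<and> (\<forall>j. 0 < j \<longrightarrow> j < m \<longrightarrow> nmul j g \<notin> H)"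
proof -
  have "\<exists>m. m > 0 \<and> nmul m g \<in> H"
    using nmul_finite[OF assms(1,2,4)] subgrp_closed(1)[OF assms(3)] by metis
  then show ?thesis by (subst (asm) exists_least_iff) metis
qed

text \<open>Adjoin elements until \<open>D\<close> is exhausted. The circle group is divisible, so
  the root required at each extension exists.\<close>

lemma trivialise_complete:
  fixes D :: "'g::ab_group_add set"
  assumes D: "finite D" "subgrp D" and b: "sym_bichar b D"
    and H: "subgrp H" "H \<subseteq> D" "trivialises b H lam"
  shows "\<exists>lam'. trivialises b D lam' \<and> (\<forall>h\<in>H. lam' h = lam h)"
  using H
proof (induction "card (D - H)" arbitrary: H lam rule: less_induct)
  case less
  show ?case
  proof (cases "H = D")
    case False
    then obtain g where g: "g \<in> D" "g \<notin> H" using less.prems by auto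
    obtain m where m: "m > 0" "nmul m g \<in> H" "\<And>j. 0 < j \<Longrightarrow> j < m \<Longrightarrow> nmul j g \<notin> H"
      using least_multiple[OF D less.prems(1) g(1)] by auto
    have nb: "norm (b g g) = 1" using b g by (auto simp: sym_bichar_def)
    then have "norm (lam (nmul m g) / b g g ^ (m choose 2)) = 1"
      using less.prems(3) m(2) by (auto simp: trivialises_def norm_divide norm_power)
    then obtain \<mu> where "norm \<mu> = 1" "\<mu> ^ m = lam (nmul m g) / b g g ^ (m choose 2)"
      using unit_root_exists m(1) by blast
    moreover from this nb have "\<mu> ^ m * b g g ^ (m choose 2) = lam (nmul m g)"
      by (metis eq_divide_eq norm_zero power_not_zero zero_neq_one)
    ultimately obtain H' lam' where H': "subgrp H'" "H \<subseteq> H'" "g \<in> H'" "H' \<subseteq> D" "trivialises b H' lam'"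
      "\<forall>h\<in>H. lam' h = lam h"
      using trivialise_extend[OF D(2) less.prems(1,2) g(1) b less.prems(3) m] by metis
    have "card (D - H') < card (D - H)"
      using D(1) H' g by (intro psubset_card_mono) auto
    then obtain lam'' where "trivialises b D lam''" "\<forall>h\<in>H'. lam'' h = lam' h"
      using less.hyps H' by blast
    then show ?thesis using H'(2,6) by (intro exI[of _ lam'']) auto
  qed (use less.prems in blast)
qed

lemma trivialisation_exists:
  fixes D :: "'g::ab_group_add set"
  assumes "finite D" "subgrp D" "sym_bichar b D"
  shows "\<exists>lam. trivialises b D lam"
proof -
  have 0: "0 \<in> D" using assms(2) by (simp add: subgrp_def)
  then have "b 0 0 = 1" using sym_bichar_nmul[OF assms(3,2), of 0 0 0] by simp
  then have "trivialises b {0} (\<lambda>_. 1)" by (simp add: trivialises_def)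
  moreover have "subgrp {0::'g}" by (simp add: subgrp_def)
  ultimately show ?thesis using trivialise_complete[OF assms, of "{0}"] 0 by blast
qed

text \<open>For the constant bicharacter 1 a trivialisation is just a character. Extend the trivial
  one from {0} by sending 1 to a root of unity other than 1, then extend to the whole field.\<close>

lemma additive_character_exists:
  "\<exists>\<psi> :: 'a::{field,finite} \<Rightarrow> complex.
     (\<forall>x y. \<psi> (x + y) = \<psi> x * \<psi> y) \<and> (\<forall>x. norm (\<psi> x) = 1) \<and> \<psi> 1 \<noteq> 1"
proof -
  let ?b = "\<lambda>_ _. 1 :: complex" and ?D = "UNIV :: 'a set" and ?H = "{0::'a}"
  have D: "subgrp ?D" "finite ?D" and H: "subgrp ?H" "?H \<subseteq> ?D" by (auto simp: subgrp_def)
  have b: "sym_bichar ?b ?D" by (simp add: sym_bichar_def)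
  have lam: "trivialises ?b ?H (\<lambda>_. 1)" by (simp add: trivialises_def)
  obtain m where m: "m > 0" "nmul m (1::'a) \<in> ?H" "\<And>j. 0 < j \<Longrightarrow> j < m \<Longrightarrow> nmul j (1::'a) \<notin> ?H"
    using least_multiple[OF D(2,1) H(1), of 1] by auto
  \<comment> \<open>The order of 1 exceeds 1 because 1 is not 0; hence the angle 2 pi / m is at most
    pi and its cosine is below 1.\<close>
  have "m \<noteq> 1" using m(2) by (auto simp: nmul.simps)
  define \<mu> where "\<mu> = cis (2 * pi / m)"
  have "cos (2 * pi / m) < cos 0"
    using m(1) \<open>m \<noteq> 1\<close> by (intro cos_monotone_0_pi) (auto simp: field_simps)
  then have "\<mu> \<noteq> 1" by (auto simp: \<mu>_def complex_eq_iff)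
  have "\<mu> ^ m = 1" unfolding \<mu>_def using m(1) by (subst Complex.DeMoivre) simp
  then obtain H' lam' where H': "subgrp H'" "(1::'a) \<in> H'" "H' \<subseteq> ?D" "trivialises ?b H' lam'" "lam' 1 = \<mu>"
    using trivialise_extend[OF D(1) H UNIV_I b lam m, of \<mu>] by (auto simp: \<mu>_def)
  then obtain \<psi> where "trivialises ?b ?D \<psi>" "\<forall>h\<in>H'. \<psi> h = lam' h"
    using trivialise_complete[OF D(2,1) b H'(1,3,4)] by blast
  then show ?thesis
    using H'(2,5) \<open>\<mu> \<noteq> 1\<close> by (intro exI[of _ \<psi>]) (auto simp: trivialises_def)
qed

section \<open>Weyl operators and stabiliser projectors\<close>

lemma op_mult_assoc:
  "op_mult X (op_mult X A B) C = op_mult X A (op_mult X B C)"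
proof (intro ext)
  fix x z
  have "op_mult X (op_mult X A B) C x z = (\<Sum>y\<in>X. \<Sum>u\<in>X. A x u * (B u y * C y z))"
    by (simp add: op_mult_def sum_distrib_right mult.assoc)
  also have "\<dots> = op_mult X A (op_mult X B C) x z"
    by (subst sum.swap) (simp add: op_mult_def sum_distrib_left)
  finally show "op_mult X (op_mult X A B) C x z = op_mult X A (op_mult X B C) x z" .
qed

lemma op_mult_sum_right:
  "op_mult X A (\<lambda>x y. \<Sum>i\<in>I. c i * B i x y) = (\<lambda>x z. \<Sum>i\<in>I. c i * op_mult X A (B i) x z)"
  unfolding op_mult_def
  by (intro ext) (simp add: sum_distrib_left sum_distrib_right sum.swap[of _ X I] algebra_simps)

lemma op_mult_sum_left:
  "op_mult X (\<lambda>x y. \<Sum>i\<in>I. c i * B i x y) A = (\<lambda>x z. \<Sum>i\<in>I. c i * op_mult X (B i) A x z)"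
  unfolding op_mult_def
  by (intro ext) (simp add: sum_distrib_left sum_distrib_right sum.swap[of _ X I] algebra_simps)

lemma op_mult_scale_right: "op_mult X A (\<lambda>x y. c * B x y) = (\<lambda>x z. c * op_mult X A B x z)"
  unfolding op_mult_def by (intro ext) (simp add: sum_distrib_left algebra_simps)

lemma op_mult_scale_left: "op_mult X (\<lambda>x y. c * B x y) A = (\<lambda>x z. c * op_mult X B A x z)"
  unfolding op_mult_def by (intro ext) (simp add: sum_distrib_left algebra_simps)

lemma op_mult_cong:
  assumes "\<And>y. y \<in> X \<Longrightarrow> A x y = A' x y" "\<And>y. y \<in> X \<Longrightarrow> B y z = B' y z"
  shows "op_mult X A B x z = op_mult X A' B' x z"
  unfolding op_mult_def using assms by (intro sum.cong) auto

section \<open>Weyl operators on a finite abelian group paired with itself\<close>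

locale weyl =
  fixes X :: "'g::ab_group_add set" and pr :: "'g \<Rightarrow> 'g \<Rightarrow> complex"
  assumes finite_X: "finite X" and subgrp_X: "subgrp X" and bichar: "sym_bichar pr X"
    and nondegenerate: "\<And>x. x \<in> X \<Longrightarrow> x \<noteq> 0 \<Longrightarrow> \<exists>y\<in>X. pr y x \<noteq> 1"
begin

lemmas X_closed = subgrp_closed[OF subgrp_X]

lemma pr_norm: "x \<in> X \<Longrightarrow> y \<in> X \<Longrightarrow> norm (pr x y) = 1"
  and pr_sym: "x \<in> X \<Longrightarrow> y \<in> X \<Longrightarrow> pr x y = pr y x"
  and pr_add_left: "x \<in> X \<Longrightarrow> y \<in> X \<Longrightarrow> z \<in> X \<Longrightarrow> pr (x + y) z = pr x z * pr y z"
  using bichar by (auto simp: sym_bichar_def)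

lemma pr_add_right: "x \<in> X \<Longrightarrow> y \<in> X \<Longrightarrow> z \<in> X \<Longrightarrow> pr z (x + y) = pr z x * pr z y"
  using pr_sym pr_add_left X_closed(4) by metis

lemma pr_0_left: "x \<in> X \<Longrightarrow> pr 0 x = 1"
  using sym_bichar_nmul[OF bichar subgrp_X, of 0 x 0] X_closed(1) by simp

lemma pr_0_right: "x \<in> X \<Longrightarrow> pr x 0 = 1"
  using pr_0_left pr_sym X_closed(1) by metis

lemma unit_mult_eq_1:
  assumes "norm (z::complex) = 1" "z * z' = 1" shows "z' = cnj z"
proof -
  have "z * cnj z = 1" using assms(1) by (simp add: complex_norm_square[symmetric])
  moreover have "z \<noteq> 0" using assms(1) by auto
  ultimately show ?thesis using assms(2) by (metis mult_left_cancel)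
qed

lemma pr_minus_right: "x \<in> X \<Longrightarrow> y \<in> X \<Longrightarrow> pr x (- y) = cnj (pr x y)"
  using unit_mult_eq_1[OF pr_norm, of x y "pr x (- y)"] pr_add_right[of y "- y" x] pr_0_right X_closed
  by simp

lemma pr_minus_left: "x \<in> X \<Longrightarrow> y \<in> X \<Longrightarrow> pr (- x) y = cnj (pr x y)"
  using pr_minus_right pr_sym X_closed(3) by metis

lemma sum_shift: "u \<in> X \<Longrightarrow> (\<Sum>t\<in>X. f (t + u)) = (\<Sum>t\<in>X. f t)"
  by (rule sum.reindex_bij_witness[of _ "\<lambda>t. t - u" "\<lambda>t. t + u"]) (auto simp: X_closed)

text \<open>For nonzero \<open>x\<close>, translating the index by a suitable \<open>y\<close>
  multiplies the sum by a factor other than 1, so the sum vanishes.\<close>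

lemma orthogonality:
  assumes "x \<in> X" shows "(\<Sum>b\<in>X. pr b x) = (if x = 0 then of_nat (card X) else 0)"
proof (cases "x = 0")
  case False
  then obtain y where y: "y \<in> X" "pr y x \<noteq> 1" using nondegenerate assms by blast
  have "(\<Sum>b\<in>X. pr b x) = (\<Sum>b\<in>X. pr (b + y) x)" using sum_shift[OF y(1), of "\<lambda>b. pr b x"] by simp
  also have "\<dots> = (\<Sum>b\<in>X. pr b x) * pr y x"
    using y(1) assms by (simp add: pr_add_left sum_distrib_right)
  finally show ?thesis using y(2) False by (metis mult_cancel_left2)
qed (simp add: pr_0_right)

text \<open>The generalised Pauli operator with label \<open>g\<close>: a phase given by the second
  component, followed by a shift by the first.\<close>

definition T :: "'g \<times> 'g \<Rightarrow> 'g \<Rightarrow> 'g \<Rightarrow> complex" where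
  "T g x y = (if y \<in> X \<and> x = y + fst g then pr (snd g) y else 0)"

lemma T_mult:
  assumes "g \<in> X \<times> X" "h \<in> X \<times> X"
  shows "op_mult X (T g) (T h) = (\<lambda>x z. pr (snd g) (fst h) * T (g + h) x z)"
proof (intro ext)
  fix x z
  have gh: "fst g \<in> X" "snd g \<in> X" "fst h \<in> X" "snd h \<in> X" using assms by auto
  have "op_mult X (T g) (T h) x z = (\<Sum>y\<in>X. if y = z + fst h then T g x y * T h (z + fst h) z else 0)"
    unfolding op_mult_def by (intro sum.cong) (auto simp: T_def)
  also have "\<dots> = (if z + fst h \<in> X then T g x (z + fst h) * T h (z + fst h) z else 0)"
    using finite_X by (simp add: sum.delta)
  also have "\<dots> = pr (snd g) (fst h) * T (g + h) x z"
    using gh X_closed(4) by (auto simp: T_def pr_add_left pr_add_right algebra_simps)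
  finally show "op_mult X (T g) (T h) x z = pr (snd g) (fst h) * T (g + h) x z" .
qed

lemma T_0: "x \<in> X \<Longrightarrow> y \<in> X \<Longrightarrow> T 0 x y = op_id x y"
  by (auto simp: T_def op_id_def pr_0_left)

text \<open>The normalised trace of the adjoint of \<open>T e\<close> times \<open>E\<close>, that
  is, the Fourier coefficient of one shifted diagonal of \<open>E\<close>.\<close>

definition coef :: "('g \<Rightarrow> 'g \<Rightarrow> complex) \<Rightarrow> 'g \<times> 'g \<Rightarrow> complex" where
  "coef E e = (\<Sum>t\<in>X. E (t + fst e) t * cnj (pr (snd e) t)) / of_nat (card X)"

lemma card_X_pos: "card X > 0"
  using finite_X X_closed(1) by (auto simp: card_gt_0_iff)

text \<open>Each shifted diagonal of \<open>E\<close> is a function on \<open>X\<close>, and this is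
  its Fourier inversion.\<close>

lemma weyl_expansion:
  assumes "x \<in> X" "y \<in> X"
  shows "E x y = (\<Sum>e\<in>X \<times> X. coef E e * T e x y)"
proof -
  have "(\<Sum>e\<in>X \<times> X. coef E e * T e x y) = (\<Sum>a\<in>X. \<Sum>b\<in>X. coef E (a, b) * T (a, b) x y)"
    by (simp add: sum.cartesian_product case_prod_unfold)
  also have "\<dots> = (\<Sum>a\<in>X. if a = x - y then (\<Sum>b\<in>X. coef E (x - y, b) * pr b y) else 0)"
    using assms by (intro sum.cong) (auto simp: T_def eq_diff_eq intro!: sum.neutral)
  also have "\<dots> = (\<Sum>b\<in>X. coef E (x - y, b) * pr b y)"
    using finite_X assms X_closed(2) by (simp add: sum.delta)
  also have "\<dots> = (\<Sum>b\<in>X. \<Sum>t\<in>X. E (t + (x - y)) t * (cnj (pr b t) * pr b y)) / of_nat (card X)"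
    by (simp add: coef_def sum_divide_distrib sum_distrib_right mult.assoc)
  also have "(\<Sum>b\<in>X. \<Sum>t\<in>X. E (t + (x - y)) t * (cnj (pr b t) * pr b y))
      = (\<Sum>t\<in>X. E (t + (x - y)) t * (\<Sum>b\<in>X. cnj (pr b t) * pr b y))"
    by (subst sum.swap) (simp add: sum_distrib_left)
  also have "\<dots> = (\<Sum>t\<in>X. if t = y then E x y * of_nat (card X) else 0)"
  proof (intro sum.cong refl)
    fix t assume t: "t \<in> X"
    have "(\<Sum>b\<in>X. cnj (pr b t) * pr b y) = (\<Sum>b\<in>X. pr b (y - t))"
      using t assms pr_add_right[of y "- t"] by (intro sum.cong) (auto simp: pr_minus_right X_closed)
    then show "E (t + (x - y)) t * (\<Sum>b\<in>X. cnj (pr b t) * pr b y)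
        = (if t = y then E x y * of_nat (card X) else 0)"
      using orthogonality[of "y - t"] t assms X_closed(2) by auto
  qed
  also have "\<dots> = E x y * of_nat (card X)" using finite_X assms by (simp add: sum.delta)
  finally show ?thesis using card_X_pos by simp
qed

lemma coef_0: "coef E 0 = (\<Sum>t\<in>X. E t t) / of_nat (card X)"
  unfolding coef_def by (simp add: pr_0_left)

text \<open>Translating the summation index by \<open>u\<close> preserves the entries of
  \<open>E\<close> but multiplies the sum by a factor other than 1.\<close>

lemma coef_eq_0_shift:
  assumes "u \<in> X" "b \<in> X" "pr b u \<noteq> 1"
    and E: "\<And>t. t \<in> X \<Longrightarrow> E (t + u + a) (t + u) = E (t + a) t"
  shows "coef E (a, b) = 0"
proof -
  let ?S = "\<Sum>t\<in>X. E (t + a) t * cnj (pr b t)"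
  have "?S = (\<Sum>t\<in>X. E (t + u + a) (t + u) * cnj (pr b (t + u)))"
    using sum_shift[OF assms(1), of "\<lambda>t. E (t + a) t * cnj (pr b t)"] by simp
  also have "\<dots> = ?S * cnj (pr b u)"
    using assms by (simp add: pr_add_right sum_distrib_right mult.assoc)
  finally have "?S = 0 \<or> cnj (pr b u) = 1" unfolding mult_cancel_left1 .
  moreover have "cnj (pr b u) \<noteq> 1" using assms(3) by (metis complex_cnj_cnj complex_cnj_one)
  ultimately show ?thesis by (simp add: coef_def)
qed

text \<open>The factor in \<open>T_mult\<close>; two Weyl operators commute when it is symmetric in
  their labels.\<close>

definition cocycle :: "'g \<times> 'g \<Rightarrow> 'g \<times> 'g \<Rightarrow> complex" where
  "cocycle g h = pr (snd g) (fst h)"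

end

section \<open>Projectors onto the joint fixed space of rescaled commuting Weyl operators\<close>

locale isotropic = weyl X pr for X :: "'g::ab_group_add set" and pr +
  fixes D :: "('g \<times> 'g) set"
  assumes subgrp_D: "subgrp D" and D_subset: "D \<subseteq> X \<times> X"
    and commute: "\<And>g h. g \<in> D \<Longrightarrow> h \<in> D \<Longrightarrow> cocycle g h = cocycle h g"
begin

lemmas D_closed = subgrp_closed[OF subgrp_D]

lemma finite_D: "finite D"
  using D_subset finite_X by (meson finite_SigmaI finite_subset)

lemma card_D_pos: "card D > 0"
  using finite_D D_closed(1) by (auto simp: card_gt_0_iff)

lemma sym_bichar_cocycle: "sym_bichar cocycle D"
  unfolding sym_bichar_def
proof (intro conjI ballI)
  fix x y assume "x \<in> D" "y \<in> D"
  then show "norm (cocycle x y) = 1" "cocycle x y = cocycle y x"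
    using D_subset commute by (auto simp: cocycle_def intro!: pr_norm)
next
  fix x y z assume "x \<in> D" "y \<in> D" "z \<in> D"
  then show "cocycle (x + y) z = cocycle x z * cocycle y z"
    using D_subset by (auto simp: cocycle_def intro!: pr_add_left)
qed

text \<open>On \<open>D\<close> commutation makes the cocycle a symmetric bicharacter, so phases
  exist for which the operators \<open>lam g\<close> times \<open>T g\<close> multiply like the
  elements of \<open>D\<close>.\<close>

definition lam :: "'g \<times> 'g \<Rightarrow> complex" where
  "lam = (SOME l. trivialises cocycle D l)"

lemma lam: "trivialises cocycle D lam"
  unfolding lam_def using trivialisation_exists[OF finite_D subgrp_D sym_bichar_cocycle] by (rule someI_ex)

lemma lam_norm: "g \<in> D \<Longrightarrow> norm (lam g) = 1"
  and lam_add: "g \<in> D \<Longrightarrow> h \<in> D \<Longrightarrow> lam (g + h) = lam g * lam h * pr (snd g) (fst h)"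
  using lam by (auto simp: trivialises_def cocycle_def)

lemma lam_0: "lam 0 = 1"
proof -
  have "lam 0 = lam 0 * lam 0"
    using lam_add[of 0 0] D_closed(1) X_closed(1) by (simp add: pr_0_left)
  then show ?thesis using lam_norm[OF D_closed(1)] by auto
qed

text \<open>This is the phase for which the rescaled operator of \<open>- g\<close> is the adjoint
  of that of \<open>g\<close>; it makes \<open>P\<close> Hermitian.\<close>

lemma lam_minus:
  assumes "g \<in> D" shows "lam (- g) = cnj (lam g) * pr (snd g) (fst g)"
proof -
  have g: "fst g \<in> X" "snd g \<in> X" using assms D_subset by auto
  have "lam g * (lam (- g) * cnj (pr (snd g) (fst g))) = 1"
    using lam_add[of g "- g"] assms D_closed(3) lam_0 g by (simp add: pr_minus_right mult.assoc)
  then have "lam (- g) * cnj (pr (snd g) (fst g)) = cnj (lam g)"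
    using unit_mult_eq_1 lam_norm assms by blast
  then have "lam (- g) * (cnj (pr (snd g) (fst g)) * pr (snd g) (fst g)) = cnj (lam g) * pr (snd g) (fst g)"
    by (metis mult.assoc)
  moreover have "cnj (pr (snd g) (fst g)) * pr (snd g) (fst g) = 1"
    using pr_norm[OF g(2,1)] by (simp add: complex_norm_square[symmetric] mult.commute)
  ultimately show ?thesis by simp
qed

definition P :: "'g \<Rightarrow> 'g \<Rightarrow> complex" where
  "P = (\<lambda>x y. \<Sum>g\<in>D. (lam g / of_nat (card D)) * T g x y)"

lemma sum_D_shift: "u \<in> D \<Longrightarrow> (\<Sum>t\<in>D. f (u + t)) = (\<Sum>t\<in>D. f t)"
  by (rule sum.reindex_bij_witness[of _ "\<lambda>t. t - u" "\<lambda>t. u + t"]) (auto simp: D_closed)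

text \<open>Multiplying by one element of the group merely permutes the summands of the
  average.\<close>

lemma T_P:
  assumes "g \<in> D" shows "op_mult X (\<lambda>x y. lam g * T g x y) P = P"
proof (intro ext)
  fix x z
  have "op_mult X (\<lambda>x y. lam g * T g x y) P x z
      = (\<Sum>h\<in>D. lam g * lam h / of_nat (card D) * op_mult X (T g) (T h) x z)"
    unfolding P_def op_mult_scale_left op_mult_sum_right by (simp add: sum_distrib_left mult.assoc)
  also have "\<dots> = (\<Sum>h\<in>D. lam (g + h) / of_nat (card D) * T (g + h) x z)"
  proof (intro sum.cong refl)
    fix h assume "h \<in> D"
    then have "lam (g + h) = lam g * lam h * pr (snd g) (fst h)" "h \<in> X \<times> X" "g \<in> X \<times> X"
      using lam_add[of g h] assms D_subset by auto
    then show "lam g * lam h / of_nat (card D) * op_mult X (T g) (T h) x z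
        = lam (g + h) / of_nat (card D) * T (g + h) x z"
      by (simp add: T_mult)
  qed
  also have "\<dots> = P x z"
    unfolding P_def using sum_D_shift[OF assms, of "\<lambda>h. lam h / of_nat (card D) * T h x z"] by simp
  finally show "op_mult X (\<lambda>x y. lam g * T g x y) P x z = P x z" .
qed

lemma P_T:
  assumes "g \<in> D" shows "op_mult X P (\<lambda>x y. lam g * T g x y) = P"
proof (intro ext)
  fix x z
  have "op_mult X P (\<lambda>x y. lam g * T g x y) x z
      = (\<Sum>h\<in>D. lam h * lam g / of_nat (card D) * op_mult X (T h) (T g) x z)"
    unfolding P_def op_mult_scale_right op_mult_sum_left by (simp add: sum_distrib_left mult_ac)
  also have "\<dots> = (\<Sum>h\<in>D. lam (g + h) / of_nat (card D) * T (g + h) x z)"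
  proof (intro sum.cong refl)
    fix h assume "h \<in> D"
    then have "lam (g + h) = lam h * lam g * pr (snd h) (fst g)" "h \<in> X \<times> X" "g \<in> X \<times> X"
      using lam_add[of h g] assms D_subset by (auto simp: add.commute)
    then show "lam h * lam g / of_nat (card D) * op_mult X (T h) (T g) x z
        = lam (g + h) / of_nat (card D) * T (g + h) x z"
      by (simp add: T_mult add.commute)
  qed
  also have "\<dots> = P x z"
    unfolding P_def using sum_D_shift[OF assms, of "\<lambda>h. lam h / of_nat (card D) * T h x z"] by simp
  finally show "op_mult X P (\<lambda>x y. lam g * T g x y) x z = P x z" .
qed

lemma P_idem: "op_mult X P P = P"
proof (intro ext)
  fix x z
  have "op_mult X P P x z = (\<Sum>g\<in>D. op_mult X (\<lambda>x y. lam g * T g x y) P x z / of_nat (card D))"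
    by (subst (1) P_def) (unfold op_mult_sum_left op_mult_scale_left, simp)
  also have "\<dots> = P x z" using card_D_pos by (simp add: T_P)
  finally show "op_mult X P P x z = P x z" .
qed

lemma P_herm:
  assumes "x \<in> X" "y \<in> X" shows "P x y = cnj (P y x)"
proof -
  have "cnj (P y x) = (\<Sum>g\<in>D. cnj (lam g) / of_nat (card D) * cnj (T g y x))"
    by (simp add: P_def)
  also have "\<dots> = (\<Sum>g\<in>D. lam (- g) / of_nat (card D) * T (- g) x y)"
  proof (intro sum.cong refl)
    fix g assume g: "g \<in> D"
    then have g': "fst g \<in> X" "snd g \<in> X" using D_subset by auto
    have "cnj (T g y x) = pr (snd g) (fst g) * T (- g) x y"
    proof (cases "y = x + fst g")
      case True
      have "cnj (pr (snd g) y) * pr (snd g) (fst g)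
         = cnj (pr (snd g) x) * (cnj (pr (snd g) (fst g)) * pr (snd g) (fst g))"
        using True assms g' by (simp add: pr_add_right)
      also have "cnj (pr (snd g) (fst g)) * pr (snd g) (fst g) = 1"
        using pr_norm[OF g'(2,1)] by (simp add: complex_norm_square[symmetric] mult.commute)
      finally show ?thesis using True assms g' by (simp add: T_def pr_minus_left mult.commute)
    qed (auto simp: T_def)
    then show "cnj (lam g) / of_nat (card D) * cnj (T g y x) = lam (- g) / of_nat (card D) * T (- g) x y"
      by (simp add: lam_minus[OF g])
  qed
  also have "\<dots> = P x y" unfolding P_def
    by (rule sum.reindex_bij_witness[of _ uminus uminus]) (auto simp: D_closed)
  finally show ?thesis by simp
qed

text \<open>A Weyl operator with nonzero label has trace 0, by its shift or by orthogonality, so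
  only the identity contributes.\<close>

lemma P_trace: "(\<Sum>y\<in>X. P y y) = of_nat (card X) / of_nat (card D)"
proof -
  have "(\<Sum>y\<in>X. P y y) = (\<Sum>g\<in>D. lam g / of_nat (card D) * (\<Sum>y\<in>X. T g y y))"
    unfolding P_def by (subst sum.swap) (simp add: sum_distrib_left)
  also have "\<dots> = (\<Sum>g\<in>D. if g = 0 then of_nat (card X) / of_nat (card D) else 0)"
  proof (intro sum.cong refl)
    fix g assume "g \<in> D"
    then have g: "fst g \<in> X" "snd g \<in> X" using D_subset by auto
    have "(\<Sum>y\<in>X. T g y y) = (if fst g = 0 then \<Sum>y\<in>X. pr y (snd g) else 0)"
      using g by (auto simp: T_def pr_sym intro!: sum.cong)
    then have "(\<Sum>y\<in>X. T g y y) = (if g = 0 then of_nat (card X) else 0)"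
      using orthogonality[OF g(2)] by (auto simp: prod_eq_iff)
    then show "lam g / of_nat (card D) * (\<Sum>y\<in>X. T g y y)
        = (if g = 0 then of_nat (card X) / of_nat (card D) else 0)"
      by (simp add: lam_0)
  qed
  also have "\<dots> = of_nat (card X) / of_nat (card D)"
    using finite_D D_closed(1) by (simp add: sum.delta)
  finally show ?thesis .
qed

text \<open>\<open>P\<close> absorbs the rescaled \<open>T g\<close> on either side. Inserting it to
  the right or to the left of \<open>T e\<close> gives the same product with two different scalars
  in front of one operator, so that operator is zero.\<close>

lemma P_T_P_eq_0:
  assumes e: "e \<in> X \<times> X" and g: "g \<in> D" and nc: "cocycle g e \<noteq> cocycle e g"
  shows "op_mult X (op_mult X P (T e)) P x z = 0"
proof -
  have gX: "g \<in> X \<times> X" using g D_subset by auto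
  let ?G = "\<lambda>x y. lam g * T g x y" and ?R = "op_mult X (op_mult X P (T e)) P"
  have "op_mult X (op_mult X P (T e)) (op_mult X ?G P) = ?R" using T_P[OF g] by simp
  then have "?R = op_mult X P (op_mult X (op_mult X (T e) ?G) P)"
    by (simp add: op_mult_assoc)
  also have "op_mult X (T e) ?G = (\<lambda>x z. lam g * cocycle e g * T (e + g) x z)"
    by (simp add: op_mult_scale_right T_mult[OF e gX] cocycle_def mult.assoc)
  finally have 1: "?R x z = lam g * cocycle e g * op_mult X P (op_mult X (T (e + g)) P) x z"
    by (simp add: op_mult_scale_right op_mult_scale_left)
  have "op_mult X (op_mult X P ?G) (op_mult X (T e) P) = ?R" using P_T[OF g] by (simp add: op_mult_assoc)
  then have "?R = op_mult X P (op_mult X (op_mult X ?G (T e)) P)"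
    by (simp add: op_mult_assoc)
  also have "op_mult X ?G (T e) = (\<lambda>x z. lam g * cocycle g e * T (e + g) x z)"
    by (simp add: op_mult_scale_left T_mult[OF gX e] cocycle_def mult.assoc add.commute)
  finally have 2: "?R x z = lam g * cocycle g e * op_mult X P (op_mult X (T (e + g)) P) x z"
    by (simp add: op_mult_scale_right op_mult_scale_left)
  have "lam g \<noteq> 0" using lam_norm[OF g] by auto
  with 1 2 nc show ?thesis by auto
qed

text \<open>After expansion of \<open>E\<close> in Weyl operators, every term with nonzero label is
  killed by compression, and the identity term is a multiple of \<open>P\<close>.\<close>

lemma knill_laflamme:
  assumes E: "\<And>e. e \<in> X \<times> X \<Longrightarrow> e \<noteq> 0 \<Longrightarrow> coef E e \<noteq> 0 \<Longrightarrow> \<exists>g\<in>D. cocycle g e \<noteq> cocycle e g"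
    and xz: "x \<in> X" "z \<in> X"
  shows "op_mult X (op_mult X P E) P x z = coef E 0 * P x z"
proof -
  let ?E = "\<lambda>x y. \<Sum>e\<in>X \<times> X. coef E e * T e x y"
  have "op_mult X (op_mult X P E) P x z = op_mult X (op_mult X P ?E) P x z"
    using weyl_expansion[of _ _ E] xz by (intro op_mult_cong) auto
  also have "\<dots> = (\<Sum>e\<in>X \<times> X. coef E e * op_mult X (op_mult X P (T e)) P x z)"
    by (simp add: op_mult_sum_right op_mult_sum_left)
  also have "\<dots> = (\<Sum>e\<in>X \<times> X. if e = 0 then coef E 0 * P x z else 0)"
  proof (intro sum.cong refl)
    fix e assume e: "e \<in> X \<times> X"
    show "coef E e * op_mult X (op_mult X P (T e)) P x z = (if e = 0 then coef E 0 * P x z else 0)"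
    proof (cases "e = 0")
      case True
      have "op_mult X (op_mult X P (T 0)) P x z = op_mult X P P x z"
      proof (rule op_mult_cong)
        fix v assume "v \<in> X"
        then have "op_mult X P (T 0) x v = (\<Sum>y\<in>X. if y = v then P x v else 0)"
          unfolding op_mult_def by (intro sum.cong) (auto simp: T_0 op_id_def)
        then show "op_mult X P (T 0) x v = P x v" using \<open>v \<in> X\<close> finite_X by (simp add: sum.delta)
      qed auto
      then show ?thesis using True by (simp add: P_idem)
    next
      case False
      then show ?thesis using E[OF e] P_T_P_eq_0[OF e] by (cases "coef E e = 0") auto
    qed
  qed
  also have "\<dots> = coef E 0 * P x z"
    using finite_X X_closed(1) by (simp add: sum.delta zero_prod_def)
  finally show ?thesis .
qed

end

section \<open>Encoders from projectors\<close>

lemma cnj_mult_self: "cnj z * z = complex_of_real ((norm z)\<^sup>2)"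
  by (metis complex_norm_square mult.commute)

lemma projector_diagonal:
  assumes "\<forall>x\<in>B. \<forall>y\<in>B. P x y = cnj (P y x)" "\<forall>x\<in>B. \<forall>y\<in>B. op_mult B P P x y = P x y" "y \<in> B"
  shows "P y y = complex_of_real (\<Sum>x\<in>B. (norm (P x y))\<^sup>2)"
proof -
  have "P y y = (\<Sum>x\<in>B. P y x * P x y)" using assms(2,3) by (simp add: op_mult_def)
  also have "\<dots> = (\<Sum>x\<in>B. cnj (P x y) * P x y)" using assms(1,3) by (intro sum.cong) metis+
  finally show ?thesis by (simp add: cnj_mult_self)
qed

text \<open>Peel off rank-one projectors. A positive trace provides a nonzero diagonal entry, hence
  a nonzero column in the range of \<open>P\<close>; subtracting the projector onto it lowers the
  trace by 1. At trace 0 the squared norms of all entries sum to 0.\<close>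

lemma projector_factor_nat:
  assumes "finite B"
    and "\<forall>x\<in>B. \<forall>y\<in>B. P x y = cnj (P y x)" "\<forall>x\<in>B. \<forall>y\<in>B. op_mult B P P x y = P x y"
    and "(\<Sum>x\<in>B. P x x) = of_nat t"
  shows "\<exists>V :: 'b \<Rightarrow> nat \<Rightarrow> complex.
     (\<forall>i<t. \<forall>j<t. (\<Sum>b\<in>B. cnj (V b i) * V b j) = (if i = j then 1 else 0)) \<and>
     (\<forall>x\<in>B. \<forall>y\<in>B. P x y = (\<Sum>i<t. V x i * cnj (V y i)))"
  using assms(2-)
proof (induction t arbitrary: P)
  case 0
  have "complex_of_real (\<Sum>y\<in>B. \<Sum>x\<in>B. (norm (P x y))\<^sup>2) = (\<Sum>y\<in>B. P y y)"
    using projector_diagonal[OF 0(1,2)] by simp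
  then have "complex_of_real (\<Sum>y\<in>B. \<Sum>x\<in>B. (norm (P x y))\<^sup>2) = 0"
    using 0(3) by (simp only: of_nat_0)
  then have "(\<Sum>y\<in>B. \<Sum>x\<in>B. (norm (P x y))\<^sup>2) = 0" by (simp only: of_real_eq_0_iff)
  then have "\<forall>y\<in>B. (\<Sum>x\<in>B. (norm (P x y))\<^sup>2) = 0"
    using assms(1) by (subst (asm) sum_nonneg_eq_0_iff) (auto intro: sum_nonneg)
  then have "P x y = 0" if "x \<in> B" "y \<in> B" for x y
    using that assms(1) by (auto simp: sum_nonneg_eq_0_iff)
  then show ?case by simp
next
  case (Suc t)
  note herm = Suc.prems(1) and idem = Suc.prems(2)
  have "\<exists>y\<in>B. P y y \<noteq> 0"
  proof (rule ccontr)
    assume "\<not> (\<exists>y\<in>B. P y y \<noteq> 0)"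
    then have "(\<Sum>x\<in>B. P x x) = 0" by simp
    then show False using Suc.prems(3) by (metis of_nat_eq_0_iff nat.distinct(2))
  qed
  then obtain y where y: "y \<in> B" "P y y \<noteq> 0" by blast
  define N where "N = (\<Sum>x\<in>B. (norm (P x y))\<^sup>2)"
  have N: "P y y = complex_of_real N" unfolding N_def by (rule projector_diagonal[OF herm idem y(1)])
  then have "N \<noteq> 0" using y(2) by auto
  moreover have "N \<ge> 0" unfolding N_def by (simp add: sum_nonneg)
  ultimately have "N > 0" by simp
  \<comment> \<open>Normalised column: by \<open>projector_diagonal\<close> its squared length
    before scaling is the diagonal entry \<open>N\<close>.\<close>
  define v where "v x = P x y / complex_of_real (sqrt N)" for x
  have sqN: "complex_of_real (sqrt N) * complex_of_real (sqrt N) = complex_of_real N"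
    using \<open>N > 0\<close> by (simp flip: of_real_mult)
  have v_norm: "(\<Sum>x\<in>B. cnj (v x) * v x) = 1"
  proof -
    have "(\<Sum>x\<in>B. cnj (v x) * v x) = (\<Sum>x\<in>B. cnj (P x y) * P x y / complex_of_real N)"
      using sqN by (simp add: v_def)
    also have "\<dots> = complex_of_real (\<Sum>x\<in>B. (norm (P x y))\<^sup>2) / complex_of_real N"
      by (simp add: cnj_mult_self sum_divide_distrib)
    also have "\<dots> = 1" using \<open>N > 0\<close> by (simp add: N_def[symmetric])
    finally show ?thesis .
  qed
  have Pv: "(\<Sum>z\<in>B. P x z * v z) = v x" if "x \<in> B" for x
    using idem that y(1) by (simp add: v_def op_mult_def flip: sum_divide_distrib)
  have vP: "(\<Sum>z\<in>B. cnj (v z) * P z x) = cnj (v x)" if "x \<in> B" for x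
  proof -
    have "(\<Sum>z\<in>B. cnj (v z) * P z x) = (\<Sum>z\<in>B. cnj (P x z * v z))"
      using herm that by (intro sum.cong refl) (metis complex_cnj_mult mult.commute)
    also have "\<dots> = cnj (\<Sum>z\<in>B. P x z * v z)" by (simp only: cnj_sum)
    finally show ?thesis by (simp only: Pv[OF that])
  qed
  define P' where "P' x z = P x z - v x * cnj (v z)" for x z
  have P'v: "(\<Sum>z\<in>B. P' x z * v z) = 0" if "x \<in> B" for x
    using Pv[OF that] v_norm
    by (simp add: P'_def left_diff_distrib sum_subtractf mult.assoc flip: sum_distrib_left)
  have vP': "(\<Sum>z\<in>B. cnj (v z) * P' z x) = 0" if "x \<in> B" for x
    using vP[OF that] v_norm
    by (simp add: P'_def right_diff_distrib sum_subtractf mult.assoc[symmetric] flip: sum_distrib_right)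
  have herm': "\<forall>x\<in>B. \<forall>z\<in>B. P' x z = cnj (P' z x)"
  proof (intro ballI)
    fix x z assume "x \<in> B" "z \<in> B"
    then have "P x z = cnj (P z x)" using herm by blast
    then show "P' x z = cnj (P' z x)" by (simp add: P'_def mult.commute)
  qed
  have idem': "\<forall>x\<in>B. \<forall>z\<in>B. op_mult B P' P' x z = P' x z"
  proof (intro ballI)
    fix x z assume xz: "x \<in> B" "z \<in> B"
    have "op_mult B P' P' x z = (\<Sum>u\<in>B. P x u * P' u z) - v x * (\<Sum>u\<in>B. cnj (v u) * P' u z)"
      by (simp add: op_mult_def P'_def[of x] left_diff_distrib sum_subtractf sum_distrib_left mult.assoc)
    also have "\<dots> = (\<Sum>u\<in>B. P x u * P u z) - (\<Sum>u\<in>B. P x u * v u) * cnj (v z)"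
      unfolding vP'[OF xz(2)] by (simp add: P'_def right_diff_distrib sum_subtractf sum_distrib_right mult.assoc)
    also have "\<dots> = P' x z" using idem xz Pv by (simp add: op_mult_def P'_def)
    finally show "op_mult B P' P' x z = P' x z" .
  qed
  have "(\<Sum>x\<in>B. P' x x) = (\<Sum>x\<in>B. P x x) - (\<Sum>x\<in>B. cnj (v x) * v x)"
    by (simp add: P'_def sum_subtractf mult.commute)
  then have "(\<Sum>x\<in>B. P' x x) = of_nat t" using v_norm Suc.prems(3) by simp
  then obtain V where V: "\<forall>i<t. \<forall>j<t. (\<Sum>b\<in>B. cnj (V b i) * V b j) = (if i = j then 1 else 0)"
    "\<forall>x\<in>B. \<forall>y\<in>B. P' x y = (\<Sum>i<t. V x i * cnj (V y i))"
    using Suc.IH[OF herm' idem'] by blast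
  have P'V: "(\<Sum>z\<in>B. P' x z * V z j) = V x j" if "x \<in> B" "j < t" for x j
  proof -
    have "(\<Sum>z\<in>B. P' x z * V z j) = (\<Sum>z\<in>B. \<Sum>i<t. V x i * (cnj (V z i) * V z j))"
      using V(2) that by (simp add: sum_distrib_right mult.assoc)
    also have "\<dots> = (\<Sum>i<t. V x i * (\<Sum>z\<in>B. cnj (V z i) * V z j))"
      by (subst sum.swap) (simp add: sum_distrib_left)
    also have "\<dots> = (\<Sum>i<t. if i = j then V x j else 0)" using V(1) that by (intro sum.cong) auto
    finally show ?thesis using that by simp
  qed
  \<comment> \<open>The columns of \<open>V\<close> are fixed by \<open>P'\<close>, whereas
    \<open>v\<close> is annihilated by it.\<close>
  have orth: "(\<Sum>b\<in>B. cnj (v b) * V b j) = 0" if "j < t" for j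
  proof -
    have "(\<Sum>b\<in>B. cnj (v b) * V b j) = (\<Sum>b\<in>B. \<Sum>z\<in>B. cnj (v b) * P' b z * V z j)"
      using P'V[OF _ that] by (simp flip: sum_distrib_left add: mult.assoc)
    also have "\<dots> = (\<Sum>z\<in>B. (\<Sum>b\<in>B. cnj (v b) * P' b z) * V z j)"
      by (subst sum.swap) (simp add: sum_distrib_right)
    finally show ?thesis using vP' by simp
  qed
  have orth': "(\<Sum>b\<in>B. cnj (V b j) * v b) = 0" if "j < t" for j
  proof -
    have "(\<Sum>b\<in>B. cnj (V b j) * v b) = cnj (\<Sum>b\<in>B. cnj (v b) * V b j)" by (simp add: mult.commute)
    then show ?thesis using orth[OF that] by simp
  qed
  show ?case
  proof (intro exI[of _ "\<lambda>x i. if i < t then V x i else v x"] conjI allI impI ballI)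
    fix i j assume "i < Suc t" "j < Suc t"
    then show "(\<Sum>b\<in>B. cnj (if i < t then V b i else v b) * (if j < t then V b j else v b))
        = (if i = j then 1 else 0)"
      using V(1) orth orth' v_norm by (cases "i < t"; cases "j < t") auto
  next
    fix x z assume "x \<in> B" "z \<in> B"
    then have "P x z = (\<Sum>i<t. V x i * cnj (V z i)) + v x * cnj (v z)"
      using V(2) by (metis P'_def diff_add_cancel)
    then show "P x z = (\<Sum>i<Suc t. (if i < t then V x i else v x) * cnj (if i < t then V z i else v z))"
      by simp
  qed
qed

lemma projector_factor:
  assumes "finite B" "finite A"
    and "\<forall>x\<in>B. \<forall>y\<in>B. P x y = cnj (P y x)" "\<forall>x\<in>B. \<forall>y\<in>B. op_mult B P P x y = P x y"
    and "(\<Sum>x\<in>B. P x x) = of_nat (card A)"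
  shows "\<exists>V :: 'b \<Rightarrow> 'i \<Rightarrow> complex.
     (\<forall>i\<in>A. \<forall>j\<in>A. (\<Sum>b\<in>B. cnj (V b i) * V b j) = (if i = j then 1 else 0)) \<and>
     (\<forall>x\<in>B. \<forall>y\<in>B. P x y = (\<Sum>i\<in>A. V x i * cnj (V y i)))"
proof -
  obtain V :: "'b \<Rightarrow> nat \<Rightarrow> complex" where
    V: "\<forall>i<card A. \<forall>j<card A. (\<Sum>b\<in>B. cnj (V b i) * V b j) = (if i = j then 1 else 0)"
    "\<forall>x\<in>B. \<forall>y\<in>B. P x y = (\<Sum>i<card A. V x i * cnj (V y i))"
    using projector_factor_nat[OF assms(1,3,4,5)] by blast
  obtain f where f: "bij_betw f A {..<card A}"
    using ex_bij_betw_finite_nat[OF assms(2)] by (auto simp: atLeast0LessThan)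
  have fA: "i \<in> A \<Longrightarrow> f i < card A" for i using f by (auto simp: bij_betw_def)
  have finj: "i \<in> A \<Longrightarrow> j \<in> A \<Longrightarrow> f i = f j \<longleftrightarrow> i = j" for i j
    using f by (auto simp: bij_betw_def inj_on_def)
  show ?thesis
  proof (intro exI[of _ "\<lambda>x i. V x (f i)"] conjI ballI)
    fix i j assume "i \<in> A" "j \<in> A"
    then show "(\<Sum>b\<in>B. cnj (V b (f i)) * V b (f j)) = (if i = j then 1 else 0)"
      using V(1) fA finj by auto
  next
    fix x y assume "x \<in> B" "y \<in> B"
    then show "P x y = (\<Sum>i\<in>A. V x (f i) * cnj (V y (f i)))"
      using V(2) sum.reindex_bij_betw[OF f, of "\<lambda>i. V x i * cnj (V y i)"] by simp
  qed
qed

section \<open>Qudit words, entangled pairs and the encoder\<close>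

lemma finite_qwords: "finite (qwords q m)" and card_qwords: "card (qwords q m) = q ^ m"
proof -
  have "qwords q m = {w. set w \<subseteq> {..<q} \<and> length w = m}" by (auto simp: qwords_def)
  then show "finite (qwords q m)" "card (qwords q m) = q ^ m"
    using finite_lists_length_eq[of "{..<q}" m] card_lists_length_eq[of "{..<q}" m] by auto
qed

lemma ebits_eq:
  assumes "x \<in> qwords q c" "y \<in> qwords q c"
  shows "ebits q c x y = (if x = y then (1 / complex_of_real (sqrt (real q))) ^ c else 0)"
proof (cases "x = y")
  case False
  then obtain j where "j < c" "x ! j \<noteq> y ! j"
    using assms by (auto simp: qwords_def list_eq_iff_nth_eq)
  then have "(\<Prod>j<c. ebit q (x ! j) (y ! j)) = 0" by (intro prod_zero) (auto simp: ebit_def)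
  then show ?thesis using False by (simp add: ebits_def)
qed (use assms in \<open>simp add: ebits_def ebit_def\<close>)

text \<open>Matrix units on the receiver's space; compressing them by the projector determines the
  receiver's reduced state.\<close>

definition unit_op :: "'b \<Rightarrow> 'b \<Rightarrow> ('b, 'b) op" where
  "unit_op y y' = (\<lambda>z z'. if z = y \<and> z' = y' then 1 else 0)"

text \<open>Reading the receiver's word \<open>y\<close> off the columns of a factor \<open>V\<close> of the projector defines
  \<open>U\<close>; it is an isometry because the reduced state of the receiver is maximally mixed.\<close>

lemma eaqecc_from_projector:
  fixes q n \<kappa> d c :: nat
  defines "B \<equiv> qwords q n \<times> qwords q c"
  assumes q: "q > 0"
    and herm: "\<forall>x\<in>B. \<forall>y\<in>B. P x y = cnj (P y x)" and idem: "\<forall>x\<in>B. \<forall>y\<in>B. op_mult B P P x y = P x y"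
    and trace: "(\<Sum>x\<in>B. P x x) = of_nat (q ^ \<kappa>)"
    and receiver: "\<And>y y' x x'. y \<in> qwords q c \<Longrightarrow> y' \<in> qwords q c \<Longrightarrow> x \<in> B \<Longrightarrow> x' \<in> B \<Longrightarrow>
      op_mult B (op_mult B P (op_tensor op_id (unit_op y y'))) P x x'
        = (if y = y' then 1 / of_nat (q ^ c) else 0) * P x x'"
    and sender: "\<And>S E. S \<subseteq> {..<n} \<Longrightarrow> card S < d \<Longrightarrow> acts_on q n S E \<Longrightarrow>
      \<exists>z. \<forall>x\<in>B. \<forall>y\<in>B. op_mult B (op_mult B P (op_tensor E op_id)) P x y = z * P x y"
  shows "\<exists>Q. eaqecc q n \<kappa> d c Q"
proof -
  let ?A = "qwords q \<kappa>" and ?r = "complex_of_real (sqrt (real q))"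
  have finB: "finite B" by (simp add: B_def finite_qwords)
  have "(\<Sum>x\<in>B. P x x) = of_nat (card ?A)" using trace by (simp add: card_qwords)
  then obtain V :: "nat list \<times> nat list \<Rightarrow> nat list \<Rightarrow> complex" where
    V: "\<forall>i\<in>?A. \<forall>j\<in>?A. (\<Sum>b\<in>B. cnj (V b i) * V b j) = (if i = j then 1 else 0)"
    and PV: "\<forall>x\<in>B. \<forall>y\<in>B. P x y = (\<Sum>i\<in>?A. V x i * cnj (V y i))"
    using projector_factor[OF finB finite_qwords[of q \<kappa>] herm idem] by blast
  have P_V: "(\<Sum>z\<in>B. P x z * V z j) = V x j" if "x \<in> B" "j \<in> ?A" for x j
  proof -
    have "(\<Sum>z\<in>B. P x z * V z j) = (\<Sum>z\<in>B. \<Sum>i\<in>?A. V x i * (cnj (V z i) * V z j))"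
      using PV that by (simp add: sum_distrib_right mult.assoc)
    also have "\<dots> = (\<Sum>i\<in>?A. V x i * (\<Sum>z\<in>B. cnj (V z i) * V z j))"
      by (subst sum.swap) (simp add: sum_distrib_left)
    also have "\<dots> = (\<Sum>i\<in>?A. if i = j then V x j else 0)" using V that by (intro sum.cong) auto
    finally show ?thesis using that finite_qwords by (simp add: sum.delta)
  qed
  have V_P: "(\<Sum>z\<in>B. cnj (V z i) * P z x) = cnj (V x i)" if "x \<in> B" "i \<in> ?A" for x i
  proof -
    have "(\<Sum>z\<in>B. cnj (V z i) * P z x) = (\<Sum>z\<in>B. cnj (P x z * V z i))"
      using herm that by (intro sum.cong refl) (metis complex_cnj_mult mult.commute)
    also have "\<dots> = cnj (\<Sum>z\<in>B. P x z * V z i)" by (simp only: cnj_sum)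
    finally show ?thesis by (simp only: P_V[OF that])
  qed
  have r: "?r \<noteq> 0" using q by simp
  have rc: "cnj (?r ^ c) * ?r ^ c = of_nat (q ^ c)"
    by (simp add: power_mult_distrib[symmetric] flip: of_real_mult)
  \<comment> \<open>The factor compensates for the amplitude of the \<open>c\<close> pairs, so that
    \<open>U\<close> applied to message and pairs reproduces \<open>V\<close>.\<close>
  define U where "U = (\<lambda>w (a, y). ?r ^ c * V (w, y) a)"
  have isom: "isometry (?A \<times> qwords q c) (qwords q n) U"
    unfolding isometry_def
  proof (intro ballI)
    fix p p' assume "p \<in> ?A \<times> qwords q c" "p' \<in> ?A \<times> qwords q c"
    then obtain a y a' y' where p: "p = (a, y)" "p' = (a', y')" "a \<in> ?A" "a' \<in> ?A"
      and y: "y \<in> qwords q c" "y' \<in> qwords q c" by auto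
    let ?F = "op_tensor op_id (unit_op y y') :: (nat list \<times> nat list, nat list \<times> nat list) op"
    let ?V' = "\<lambda>i x. cnj (V x i)" and ?z = "if y = y' then 1 / of_nat (q ^ c) else 0 :: complex"
    \<comment> \<open>The inner product over the channel alone is an entry of V* F V, where F is a
      matrix unit on the receiver's side.\<close>
    have "(\<Sum>w\<in>qwords q n. cnj (V (w, y) a) * V (w, y') a') = op_mult B (op_mult B ?V' ?F) V a a'"
    proof -
      have 1: "op_mult B ?V' ?F a (w', z') = (if z' = y' then cnj (V (w', y) a) else 0)"
        if "(w', z') \<in> B" for w' z'
      proof -
        have "op_mult B ?V' ?F a (w', z')
            = (\<Sum>x\<in>B. if x = (w', y) then (if z' = y' then cnj (V (w', y) a) else 0) else 0)"
          unfolding op_mult_def by (intro sum.cong) (auto simp: op_tensor_def op_id_def unit_op_def split: if_splits)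
        then show ?thesis using that y finB by (simp add: sum.delta B_def)
      qed
      have "op_mult B (op_mult B ?V' ?F) V a a'
          = (\<Sum>w\<in>qwords q n. \<Sum>z\<in>qwords q c. op_mult B ?V' ?F a (w, z) * V (w, z) a')"
        unfolding op_mult_def[of B "op_mult B ?V' ?F"] by (simp add: B_def sum.cartesian_product case_prod_unfold)
      also have "\<dots> = (\<Sum>w\<in>qwords q n. \<Sum>z\<in>qwords q c. if z = y' then cnj (V (w, y) a) * V (w, y') a' else 0)"
        by (intro sum.cong refl) (simp add: 1[unfolded B_def] B_def)
      finally show ?thesis using y finite_qwords by (simp add: sum.delta)
    qed
    also have "\<dots> = op_mult B ?V' (op_mult B ?F V) a a'" by (simp add: op_mult_assoc)
    \<comment> \<open>Since V = P V, projectors can be inserted on both sides of F, which exposes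
      the product that \<open>receiver\<close> evaluates.\<close>
    also have "\<dots> = op_mult B (op_mult B ?V' P) (op_mult B ?F (op_mult B P V)) a a'"
    proof -
      have "op_mult B ?V' P a x = cnj (V x a)" if "x \<in> B" for x
        using V_P[OF that p(3)] by (simp add: op_mult_def)
      moreover have "op_mult B P V x a' = V x a'" if "x \<in> B" for x
        using P_V[OF that p(4)] by (simp add: op_mult_def)
      ultimately show ?thesis by (intro op_mult_cong) simp_all
    qed
    also have "\<dots> = op_mult B ?V' (op_mult B (op_mult B (op_mult B P ?F) P) V) a a'"
      by (simp add: op_mult_assoc)
    also have "\<dots> = ?z * op_mult B ?V' (op_mult B P V) a a'"
    proof -
      have "op_mult B (op_mult B (op_mult B P ?F) P) V x a' = ?z * op_mult B P V x a'" if "x \<in> B" for x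
        using receiver[OF y that]
        unfolding op_mult_def[of B _ V] by (simp add: sum_distrib_left mult.assoc)
      then show ?thesis unfolding op_mult_def[of B ?V'] by (simp add: sum_distrib_left mult_ac)
    qed
    also have "op_mult B ?V' (op_mult B P V) a a' = (if a = a' then 1 else 0)"
      using P_V[OF _ p(4)] V p(3,4) by (simp add: op_mult_def)
    finally have main: "(\<Sum>w\<in>qwords q n. cnj (V (w, y) a) * V (w, y') a')
        = ?z * (if a = a' then 1 else 0)" .
    have "(\<Sum>w\<in>qwords q n. cnj (U w p) * U w p')
        = cnj (?r ^ c) * ?r ^ c * (\<Sum>w\<in>qwords q n. cnj (V (w, y) a) * V (w, y') a')"
      by (simp add: U_def p sum_distrib_left mult_ac)
    also have "\<dots> = op_id p p'"
      unfolding main rc using q by (simp add: op_id_def p)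
    finally show "(\<Sum>w\<in>qwords q n. cnj (U w p) * U w p') = op_id p p'" .
  qed
  \<comment> \<open>\<open>W\<close> is the map given by \<open>V\<close> alone; encoding with the
    pairs attached is shown to equal it, so the code space is the range of \<open>P\<close>.\<close>
  define W where "W \<phi> = (\<lambda>x. if x \<in> B then \<Sum>a\<in>?A. V x a * \<phi> a else 0)"
    for \<phi> :: "nat list \<Rightarrow> complex"
  have "op_apply ((?A \<times> qwords q c) \<times> qwords q c) B (op_tensor U op_id)
      (\<lambda>((a, x), y). \<phi> a * ebits q c x y) = W \<phi>" for \<phi>
  proof
    fix wy :: "nat list \<times> nat list"
    obtain w y where wy: "wy = (w, y)" by (cases wy)
    show "op_apply ((?A \<times> qwords q c) \<times> qwords q c) B (op_tensor U op_id)
      (\<lambda>((a, x), y). \<phi> a * ebits q c x y) wy = W \<phi> wy"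
    proof (cases "wy \<in> B")
      case True
      then have y: "y \<in> qwords q c" by (simp add: wy B_def)
      have "(\<Sum>b\<in>(?A \<times> qwords q c) \<times> qwords q c.
            op_tensor U op_id (w, y) b * (case b of ((a, x), y) \<Rightarrow> \<phi> a * ebits q c x y))
          = (\<Sum>a\<in>?A. \<Sum>x\<in>qwords q c. \<Sum>z\<in>qwords q c.
               if z = y then (if x = y then V (w, y) a * \<phi> a else 0) else 0)"
        unfolding sum.cartesian_product'
        by (intro sum.cong refl) (use r in \<open>auto simp: op_tensor_def op_id_def U_def ebits_eq power_divide\<close>)
      also have "\<dots> = (\<Sum>a\<in>?A. V (w, y) a * \<phi> a)"
        using y finite_qwords by (simp add: sum.delta)
      finally show ?thesis using True by (simp add: op_apply_def W_def wy case_prod_unfold)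
    qed (simp add: op_apply_def W_def)
  qed
  then have code: "ea_code_space q n \<kappa> c U = W ` hspace ?A"
    unfolding ea_code_space_def B_def by simp
  have "is_projector B (W ` hspace ?A) P"
    unfolding is_projector_def
  proof (intro conjI herm idem equalityI subsetI)
    fix f assume "f \<in> op_apply B B P ` hspace B"
    then obtain g where f: "f = op_apply B B P g" by auto
    let ?h = "\<lambda>a. if a \<in> ?A then \<Sum>y\<in>B. cnj (V y a) * g y else 0"
    have "f = W ?h"
    proof
      fix x
      have "(\<Sum>y\<in>B. P x y * g y) = (\<Sum>a\<in>?A. V x a * ?h a)" if "x \<in> B"
      proof -
        have "(\<Sum>y\<in>B. P x y * g y) = (\<Sum>y\<in>B. \<Sum>a\<in>?A. V x a * (cnj (V y a) * g y))"
          using PV that by (simp add: sum_distrib_right mult.assoc)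
        also have "\<dots> = (\<Sum>a\<in>?A. V x a * ?h a)"
          by (subst sum.swap) (simp add: sum_distrib_left)
        finally show ?thesis .
      qed
      then show "f x = W ?h x" by (simp add: f op_apply_def W_def)
    qed
    moreover have "?h \<in> hspace ?A" by (simp add: hspace_def)
    ultimately show "f \<in> W ` hspace ?A" by blast
  next
    fix f assume "f \<in> W ` hspace ?A"
    then obtain g where f: "f = W g" by auto
    have "op_apply B B P f = f"
    proof
      fix x
      have "(\<Sum>y\<in>B. P x y * f y) = f x" if "x \<in> B"
      proof -
        have "(\<Sum>y\<in>B. P x y * f y) = (\<Sum>y\<in>B. \<Sum>a\<in>?A. P x y * V y a * g a)"
          by (simp add: f W_def sum_distrib_left mult.assoc)
        also have "\<dots> = (\<Sum>a\<in>?A. (\<Sum>y\<in>B. P x y * V y a) * g a)"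
          by (subst sum.swap) (simp add: sum_distrib_right)
        finally show ?thesis using P_V that by (simp add: f W_def)
      qed
      then show "op_apply B B P f x = f x" by (simp add: op_apply_def f W_def)
    qed
    moreover have "f \<in> hspace B" by (simp add: f W_def hspace_def)
    ultimately show "f \<in> op_apply B B P ` hspace B" by (metis imageI)
  qed
  then have "detects q n c d (W ` hspace ?A)"
    unfolding detects_def Let_def B_def[symmetric] using sender by (intro exI[of _ P] conjI) blast+
  then have "eaqecc q n \<kappa> d c (W ` hspace ?A)"
    unfolding eaqecc_def using isom code by auto
  then show ?thesis by blast
qed

section \<open>Generalised Reed--Solomon codes and their Hermitian hulls\<close>

lemma card_vec_span:
  fixes B :: "('a::{field,finite} ^ 'n::finite) set"
  assumes "vec.independent B"
  shows "card (vec.span B) = CARD('a) ^ card B"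
  using finite[of B] assms
proof (induction B rule: finite_induct)
  case (insert b B)
  have ind: "vec.independent B" "b \<notin> vec.span B"
    using insert.prems insert.hyps by (simp_all add: vec.independent_insert)
  let ?f = "\<lambda>(k, x). x + k *s b"
  have "bij_betw ?f (UNIV \<times> vec.span B) (vec.span (insert b B))"
    unfolding bij_betw_def
  proof
    show "inj_on ?f (UNIV \<times> vec.span B)"
    proof (rule inj_onI, clarsimp)
      fix k x k' x' assume x: "x \<in> vec.span B" "x' \<in> vec.span B" and e: "x + k *s b = x' + k' *s b"
      have eq: "(k' - k) *s b = x - x'"
        using e by (simp add: vec.scale_left_diff_distrib algebra_simps)
      have "k = k'"
      proof (rule ccontr)
        assume "k \<noteq> k'"
        then have "inverse (k' - k) *s ((k' - k) *s b) = b"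
          by (simp only: vector_smult_assoc) simp
        then have "b = inverse (k' - k) *s (x - x')" by (simp only: eq)
        then show False using ind(2) x vec.span_diff vec.span_scale by metis
      qed
      then show "k = k' \<and> x = x'" using e by simp
    qed
    show "?f ` (UNIV \<times> vec.span B) = vec.span (insert b B)"
    proof (intro equalityI subsetI)
      fix y assume "y \<in> vec.span (insert b B)"
      then obtain k where "y - k *s b \<in> vec.span B" by (auto simp: vec.span_insert)
      then show "y \<in> ?f ` (UNIV \<times> vec.span B)"
        by (intro image_eqI[of _ _ "(k, y - k *s b)"]) auto
    next
      fix y assume "y \<in> ?f ` (UNIV \<times> vec.span B)"
      then obtain k x where "y = x + k *s b" "x \<in> vec.span B" by auto
      then have "y - k *s b \<in> vec.span B" by simp
      then show "y \<in> vec.span (insert b B)" by (auto simp: vec.span_insert)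
    qed
  qed
  then have "card (vec.span (insert b B)) = CARD('a) * card (vec.span B)"
    by (metis bij_betw_same_card card_cartesian_product)
  then show ?case using insert ind by simp
qed simp

lemma card_vec_subspace:
  fixes S :: "('a::{field,finite} ^ 'n::finite) set"
  assumes "vec.subspace S"
  shows "card S = CARD('a) ^ vec.dim S"
proof -
  obtain B where B: "B \<subseteq> S" "vec.independent B" "S \<subseteq> vec.span B" "card B = vec.dim S"
    using vec.basis_exists by blast
  then have "vec.span B = S" using assms vec.span_minimal by blast
  then show ?thesis using card_vec_span[OF B(2)] B(4) by simp
qed

lemma card_gt_1_field: "CARD('a::{field,finite}) > 1"
  using card_mono[of UNIV "{0, 1 :: 'a}"] by simp

text \<open>Rank-nullity for one additive functional: each nonempty fibre translates into the
  kernel, and there are at most as many fibres as field elements.\<close>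

lemma card_kernel:
  fixes S :: "('a::{field,finite} ^ 'n::finite) set" and f :: "'a ^ 'n \<Rightarrow> 'a"
  assumes S: "vec.subspace S" and f: "\<And>x y. f (x - y) = f x - f y"
  shows "card S \<le> CARD('a) * card {x\<in>S. f x = 0}"
proof -
  have "card S \<le> card (f ` S) * card {x\<in>S. f x = 0}"
  proof (rule card_le_fibres)
    fix t assume "t \<in> f ` S"
    then obtain z where z: "z \<in> S" "t = f z" by auto
    show "card {x\<in>S. f x = t} \<le> card {x\<in>S. f x = 0}"
      by (rule card_inj_on_le[of "\<lambda>x. x - z"]) (use z f vec.subspace_diff[OF S] in \<open>auto simp: inj_on_def\<close>)
  qed simp
  also have "\<dots> \<le> CARD('a) * card {x\<in>S. f x = 0}"
    by (intro mult_right_mono card_mono) auto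
  finally show ?thesis .
qed

section \<open>Evaluation codes: generators, size, interpolation and rescaling\<close>

definition grs :: "'a::field ^ 'n::finite \<Rightarrow> 'a ^ 'n \<Rightarrow> nat \<Rightarrow> ('a ^ 'n) set" where
  "grs a v k = {(\<chi> j. v $ j * poly f (a $ j)) | f. f = 0 \<or> degree f < k}"

lemma grs_code_altdef:
  "grs_code k (C :: ('a::field ^ 'n::finite) set) \<longleftrightarrow> k \<le> CARD('n) \<and>
     (\<exists>a v. inj (($) a) \<and> (\<forall>j. v $ j \<noteq> 0) \<and> C = grs a v k)"
  by (simp add: grs_code_def grs_def)

text \<open>The condition on coefficients is visibly linear and absorbs the exceptional case of the
  zero polynomial.\<close>

lemma degree_less_iff_coeff: "f = 0 \<or> degree f < k \<longleftrightarrow> (\<forall>i\<ge>k. coeff f i = 0)"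
  by (metis coeff_0 coeff_eq_0 leading_coeff_0_iff linorder_not_le order_less_le_trans)

lemma grs_memI: "(\<forall>i\<ge>k. coeff f i = 0) \<Longrightarrow> (\<chi> j. v $ j * poly f (a $ j)) \<in> grs a v k"
  unfolding grs_def degree_less_iff_coeff by blast

lemma grs_memE:
  assumes "x \<in> grs a v k"
  obtains f where "\<forall>i\<ge>k. coeff f i = 0" "x = (\<chi> j. v $ j * poly f (a $ j))"
  using assms unfolding grs_def degree_less_iff_coeff by blast

lemma grs_subspace: "vec.subspace (grs a v k)"
proof (rule vec.subspaceI)
  show "0 \<in> grs a v k" using grs_memI[of k 0 v a] by (simp add: zero_vec_def)
  fix x y assume xy: "x \<in> grs a v k" "y \<in> grs a v k"
  obtain f where f: "\<forall>i\<ge>k. coeff f i = 0" "x = (\<chi> j. v $ j * poly f (a $ j))"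
    by (rule grs_memE[OF xy(1)])
  obtain g where g: "\<forall>i\<ge>k. coeff g i = 0" "y = (\<chi> j. v $ j * poly g (a $ j))"
    by (rule grs_memE[OF xy(2)])
  have "x + y = (\<chi> j. v $ j * poly (f + g) (a $ j))"
    by (simp add: f g vec_eq_iff algebra_simps)
  then show "x + y \<in> grs a v k" using grs_memI[of k "f + g" v a] f(1) g(1) by simp
next
  fix c x assume "x \<in> grs a v k"
  then obtain f where f: "\<forall>i\<ge>k. coeff f i = 0" "x = (\<chi> j. v $ j * poly f (a $ j))"
    by (rule grs_memE)
  have "c *s x = (\<chi> j. v $ j * poly (smult c f) (a $ j))"
    by (simp add: f vec_eq_iff algebra_simps)
  then show "c *s x \<in> grs a v k" using grs_memI[of k "smult c f" v a] f(1) by simp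
qed

text \<open>The generator that is added when the degree bound is raised from \<open>k\<close> to k +
  1.\<close>

definition grs_power :: "'a::field ^ 'n::finite \<Rightarrow> 'a ^ 'n \<Rightarrow> nat \<Rightarrow> 'a ^ 'n" where
  "grs_power a v k = (\<chi> j. v $ j * (a $ j) ^ k)"

lemma grs_Suc_eq: "grs a v (Suc k) = {t *s grs_power a v k + x |t x. x \<in> grs a v k}"
proof (intro equalityI subsetI)
  fix y assume "y \<in> grs a v (Suc k)"
  then obtain f where f: "\<forall>i\<ge>Suc k. coeff f i = 0" "y = (\<chi> j. v $ j * poly f (a $ j))"
    by (rule grs_memE)
  define g where "g = f - monom (coeff f k) k"
  have "\<forall>i\<ge>k. coeff g i = 0" using f(1) by (auto simp: g_def le_Suc_eq Suc_le_eq)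
  then have "(\<chi> j. v $ j * poly g (a $ j)) \<in> grs a v k" by (rule grs_memI)
  moreover have "y = coeff f k *s grs_power a v k + (\<chi> j. v $ j * poly g (a $ j))"
    by (simp add: f(2) g_def grs_power_def vec_eq_iff poly_monom algebra_simps)
  ultimately show "y \<in> {t *s grs_power a v k + x |t x. x \<in> grs a v k}" by blast
next
  fix y assume "y \<in> {t *s grs_power a v k + x |t x. x \<in> grs a v k}"
  then obtain t x where y: "y = t *s grs_power a v k + x" "x \<in> grs a v k" by auto
  obtain f where f: "\<forall>i\<ge>k. coeff f i = 0" "x = (\<chi> j. v $ j * poly f (a $ j))"
    by (rule grs_memE[OF y(2)])
  have "y = (\<chi> j. v $ j * poly (monom t k + f) (a $ j))"
    by (simp add: f(2) y(1) grs_power_def vec_eq_iff poly_monom algebra_simps)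
  then show "y \<in> grs a v (Suc k)" using grs_memI[of "Suc k" "monom t k + f" v a] f(1) by simp
qed

text \<open>Otherwise a monic polynomial of degree \<open>k\<close> would vanish at more than
  \<open>k\<close> distinct points.\<close>

lemma grs_power_notin:
  fixes a v :: "'a::field ^ 'n::finite"
  assumes a: "inj (($) a)" and v: "\<And>j. v $ j \<noteq> 0" and k: "k < CARD('n)"
  shows "grs_power a v k \<notin> grs a v k"
proof
  assume "grs_power a v k \<in> grs a v k"
  then obtain f where f: "\<forall>i\<ge>k. coeff f i = 0" "grs_power a v k = (\<chi> j. v $ j * poly f (a $ j))"
    by (rule grs_memE)
  let ?p = "monom 1 k - f"
  have c: "coeff ?p k = 1" using f(1) by simp
  then have nz: "?p \<noteq> 0" by auto
  have "degree ?p \<le> k" using f(1) by (intro degree_le) simp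
  have "poly ?p (a $ j) = 0" for j
    using arg_cong[OF f(2), of "\<lambda>x. x $ j"] v[of j] by (simp add: grs_power_def poly_monom)
  then have "range (($) a) \<subseteq> {x. poly ?p x = 0}" by auto
  then have "card (range (($) a)) \<le> card {x. poly ?p x = 0}"
    by (rule card_mono[OF poly_roots_finite[OF nz]])
  also have "\<dots> \<le> k" using card_poly_roots_bound[OF nz] \<open>degree ?p \<le> k\<close> by simp
  finally show False using k card_image[OF a] by simp
qed

lemma card_grs:
  fixes a v :: "'a::{field,finite} ^ 'n::finite"
  assumes a: "inj (($) a)" and v: "\<And>j. v $ j \<noteq> 0" and "k \<le> CARD('n)"
  shows "card (grs a v k) = CARD('a) ^ k"
  using assms(3)
proof (induction k)
  case 0
  have "grs a v 0 = {0}"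
    by (auto simp: grs_def vec_eq_iff)
  then show ?case by simp
next
  case (Suc k)
  let ?p = "grs_power a v k"
  obtain B where B: "B \<subseteq> grs a v k" "vec.independent B" "vec.span B = grs a v k"
    using vec.basis_exists grs_subspace vec.span_minimal by (metis subset_antisym)
  have "?p \<notin> vec.span B" using B(3) grs_power_notin[OF a v] Suc.prems by auto
  then have ind: "vec.independent (insert ?p B)" "?p \<notin> B"
    using B(2) vec.span_base by (auto simp: vec.independent_insert)
  have "vec.span (insert ?p B) = grs a v (Suc k)"
  proof (intro equalityI subsetI)
    fix y assume "y \<in> vec.span (insert ?p B)"
    then obtain t where "y - t *s ?p \<in> grs a v k" by (auto simp: vec.span_insert B(3))
    moreover have "y = t *s ?p + (y - t *s ?p)" by simp
    ultimately show "y \<in> grs a v (Suc k)" unfolding grs_Suc_eq by blast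
  next
    fix y assume "y \<in> grs a v (Suc k)"
    then obtain t x where "y = t *s ?p + x" "x \<in> grs a v k" by (auto simp: grs_Suc_eq)
    then have "y - t *s ?p \<in> vec.span B" by (simp add: B(3))
    then show "y \<in> vec.span (insert ?p B)" by (auto simp: vec.span_insert)
  qed
  then have "card (grs a v (Suc k)) = CARD('a) * CARD('a) ^ card B"
    using card_vec_span[OF ind(1)] ind(2) by simp
  also have "CARD('a) ^ card B = CARD('a) ^ k"
    using card_vec_span[OF B(2)] B(3) Suc by simp
  finally show ?case by simp
qed

lemma grs_code_subspace: "grs_code k C \<Longrightarrow> vec.subspace C"
  by (auto simp: grs_code_altdef grs_subspace)

lemma grs_code_card: "grs_code k (C :: ('a::{field,finite} ^ 'n::finite) set) \<Longrightarrow> card C = CARD('a) ^ k"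
  by (auto simp: grs_code_altdef card_grs)

text \<open>The numerator of a Lagrange polynomial has degree card S - 1, which is below
  \<open>k\<close>. Codewords isolating one position of \<open>S\<close> are what detection of
  errors on at most \<open>k\<close> qudits rests on.\<close>

lemma grs_code_interpolate:
  fixes C :: "('a::field ^ 'n::finite) set"
  assumes "grs_code k C" "card S \<le> k" "j0 \<in> S"
  shows "\<exists>x\<in>C. x $ j0 \<noteq> 0 \<and> (\<forall>j\<in>S - {j0}. x $ j = 0)"
proof -
  obtain a v where a: "inj (($) a)" and v: "\<And>j. v $ j \<noteq> 0" and C: "C = grs a v k"
    using assms(1) by (auto simp: grs_code_altdef)
  let ?f = "\<Prod>j\<in>S - {j0}. [:- (a $ j), 1:]"
  have "card S > 0" using assms(3) by (auto simp: card_gt_0_iff)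
  moreover have "degree ?f = card (S - {j0})"
    by (subst degree_prod_eq_sum_degree) auto
  ultimately have "degree ?f < k" using assms(2,3) by (simp add: card_Diff_singleton)
  then have "(\<chi> j. v $ j * poly ?f (a $ j)) \<in> C" unfolding C grs_def by blast
  moreover have "poly ?f (a $ j0) \<noteq> 0"
    using injD[OF a] by (auto simp: poly_prod)
  moreover have "\<forall>j\<in>S - {j0}. poly ?f (a $ j) = 0" by (auto simp: poly_prod)
  ultimately show ?thesis using v by (intro bexI[of _ "\<chi> j. v $ j * poly ?f (a $ j)"]) auto
qed

definition scale_coord :: "'n \<Rightarrow> 'a::field \<Rightarrow> 'a ^ 'n::finite \<Rightarrow> 'a ^ 'n" where
  "scale_coord j \<alpha> x = (\<chi> i. if i = j then \<alpha> * x $ i else x $ i)"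

lemma grs_code_scale:
  assumes "grs_code k C" "\<alpha> \<noteq> 0" shows "grs_code k (scale_coord j \<alpha> ` C)"
proof -
  obtain a v where a: "k \<le> CARD('b)" "inj (($) a)" "\<forall>j. v $ j \<noteq> 0" "C = grs a v k"
    using assms(1) by (auto simp: grs_code_altdef)
  have "scale_coord j \<alpha> (\<chi> i. v $ i * poly f (a $ i)) = (\<chi> i. scale_coord j \<alpha> v $ i * poly f (a $ i))" for f
    by (simp add: scale_coord_def vec_eq_iff)
  then have "scale_coord j \<alpha> ` C = grs a (scale_coord j \<alpha> v) k"
    unfolding a(4) grs_def setcompr_eq_image image_image by simp
  moreover have "\<forall>i. scale_coord j \<alpha> v $ i \<noteq> 0" using a(3) assms(2) by (simp add: scale_coord_def)
  ultimately show ?thesis using a by (auto simp: grs_code_altdef)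
qed

section \<open>The Hermitian form, hulls of GRS codes, and orthonormal systems\<close>

context quadratic_extension
begin

definition herm :: "'a ^ 'n::finite \<Rightarrow> 'a ^ 'n \<Rightarrow> 'a" where
  "herm x y = (\<Sum>i\<in>UNIV. x $ i * (y $ i) ^ q)"

lemma herm_add_left: "herm (x + y) z = herm x z + herm y z"
  and herm_diff_left: "herm (x - y) z = herm x z - herm y z"
  and herm_scale_left: "herm (c *s x) z = c * herm x z"
  by (simp_all add: herm_def algebra_simps sum.distrib sum_subtractf sum_distrib_left)

lemma herm_0_left [simp]: "herm 0 z = 0" by (simp add: herm_def)

lemma herm_conj: "herm x y ^ q = herm y x"
  by (simp add: herm_def conj_sum power_mult_distrib mult.commute)

lemma herm_add_right: "herm z (x + y) = herm z x + herm z y"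
  and herm_scale_right: "herm z (c *s x) = c ^ q * herm z x"
  by (simp_all add: herm_def conj_add power_mult_distrib algebra_simps sum.distrib sum_distrib_left)

lemma herm_sum_left: "herm (\<Sum>j\<in>J. f j) z = (\<Sum>j\<in>J. herm (f j) z)"
  by (induction J rule: infinite_finite_induct) (auto simp: herm_add_left)

lemma herm_0_right [simp]: "herm z 0 = 0" by (simp add: herm_def)

lemma herm_sum_right: "herm z (\<Sum>j\<in>J. f j) = (\<Sum>j\<in>J. herm z (f j))"
  by (induction J rule: infinite_finite_induct) (auto simp: herm_add_right)

lemma herm_swap_0: "herm x y = 0 \<longleftrightarrow> herm y x = 0"
  by (metis conj_eq_0 herm_conj)

text \<open>The definition of the dual conjugates the other argument; this is harmless since
  vanishing of the form is symmetric.\<close>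

lemma hermitian_dual_eq: "hermitian_dual q C = {x :: 'a ^ 'n::finite. \<forall>y\<in>C. herm x y = 0}"
  unfolding hermitian_dual_def using herm_swap_0 by (auto simp: herm_def)

lemma hermitian_hull_eq: "hermitian_hull q C = {x :: 'a ^ 'n::finite. x \<in> C \<and> (\<forall>y\<in>C. herm x y = 0)}"
  by (auto simp: hermitian_hull_def hermitian_dual_eq)

lemma hermitian_hull_subspace:
  assumes "vec.subspace (C :: ('a ^ 'n::finite) set)" shows "vec.subspace (hermitian_hull q C)"
  using vec.subspace_0[OF assms] vec.subspace_add[OF assms] vec.subspace_scale[OF assms]
  by (auto simp: hermitian_hull_eq herm_add_left herm_scale_left intro!: vec.subspaceI)

lemma dim_le_Suc:
  assumes "vec.subspace (S :: ('a ^ 'n::finite) set)" "vec.subspace (S' :: ('a ^ 'n) set)"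
    and "card S \<le> CARD('a) * card S'"
  shows "vec.dim S \<le> vec.dim S' + 1"
proof -
  have "CARD('a) ^ vec.dim S \<le> CARD('a) ^ (vec.dim S' + 1)"
    using assms card_vec_subspace by (metis Suc_eq_plus1 power_Suc)
  then show ?thesis using card_gt_1_field[where 'a='a] by (simp only: power_increasing_iff)
qed

lemma grs_hull_extend_step:
  fixes C :: "('a ^ 'n::finite) set"
  assumes "grs_code k C" "k < CARD('n)"
  shows "\<exists>C' :: ('a ^ 'n) set. grs_code (Suc k) C' \<and>
           vec.dim (hermitian_hull q C) \<le> vec.dim (hermitian_hull q C') + 1"
proof -
  obtain a v where a: "inj (($) a)" "\<forall>j. v $ j \<noteq> 0" "C = grs a v k"
    using assms(1) by (auto simp: grs_code_altdef)
  let ?C' = "grs a v (Suc k)" and ?p = "grs_power a v k"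
  have C': "grs_code (Suc k) ?C'" using a assms(2) by (auto simp: grs_code_altdef)
  have "{x \<in> hermitian_hull q C. herm x ?p = 0} \<subseteq> hermitian_hull q ?C'"
  proof
    fix x assume "x \<in> {x \<in> hermitian_hull q C. herm x ?p = 0}"
    then have x: "x \<in> C" "\<forall>y\<in>C. herm x y = 0" "herm x ?p = 0" by (auto simp: hermitian_hull_eq)
    have "0 *s ?p + x \<in> ?C'" unfolding grs_Suc_eq using x(1) a(3) by blast
    then show "x \<in> hermitian_hull q ?C'"
      using x a(3) by (auto simp: hermitian_hull_eq grs_Suc_eq herm_add_right herm_scale_right)
  qed
  then have "card {x \<in> hermitian_hull q C. herm x ?p = 0} \<le> card (hermitian_hull q ?C')"
    by (intro card_mono) auto
  moreover have "card (hermitian_hull q C) \<le> CARD('a) * card {x \<in> hermitian_hull q C. herm x ?p = 0}"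
    using card_kernel[OF hermitian_hull_subspace[OF grs_code_subspace[OF assms(1)]], of "\<lambda>x. herm x ?p"]
    by (simp add: herm_diff_left)
  ultimately have "card (hermitian_hull q C) \<le> CARD('a) * card (hermitian_hull q ?C')"
    by (meson le_trans mult_le_mono2)
  then show ?thesis
    using dim_le_Suc C' hermitian_hull_subspace grs_code_subspace assms(1) by blast
qed

lemma grs_hull_extend:
  fixes C :: "('a ^ 'n::finite) set"
  assumes "grs_code k C" "k + i \<le> CARD('n)"
  shows "\<exists>C' :: ('a ^ 'n) set. grs_code (k + i) C' \<and>
           vec.dim (hermitian_hull q C) \<le> vec.dim (hermitian_hull q C') + i"
  using assms(2)
proof (induction i)
  case 0 then show ?case using assms(1) by auto
next
  case (Suc i)
  then obtain C' :: "('a ^ 'n) set" where "grs_code (k + i) C'"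
    "vec.dim (hermitian_hull q C) \<le> vec.dim (hermitian_hull q C') + i" by auto
  moreover from this obtain C'' :: "('a ^ 'n) set" where "grs_code (Suc (k + i)) C''"
    "vec.dim (hermitian_hull q C') \<le> vec.dim (hermitian_hull q C'') + 1"
    using grs_hull_extend_step Suc.prems by (metis Suc_le_lessD add_Suc_right)
  ultimately show ?case by (intro exI[of _ C'']) auto
qed

text \<open>Only the j-th term changes, by the norm of the scaling factor.\<close>

lemma herm_scale_coord:
  "herm (scale_coord j \<alpha> x) (scale_coord j \<alpha> y)
    = herm x y + (\<alpha> ^ (q + 1) - 1) * x $ j * (y $ j) ^ q"
proof -
  have "herm (scale_coord j \<alpha> x) (scale_coord j \<alpha> y)
    = (\<Sum>i\<in>UNIV. x $ i * (y $ i) ^ q + (if i = j then (\<alpha> ^ (q + 1) - 1) * x $ j * (y $ j) ^ q else 0))"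
    unfolding herm_def by (intro sum.cong) (auto simp: scale_coord_def power_mult_distrib algebra_simps)
  then show ?thesis by (simp add: sum.distrib herm_def)
qed

text \<open>Testing a vector of the new hull against \<open>x\<close>, which is orthogonal to all of \<open>C\<close>, leaves only
  the \<open>j\<close>-th terms and so forces its \<open>j\<close>-th entry to be zero.\<close>

lemma hull_scale_coord:
  fixes C :: "('a ^ 'n::finite) set"
  assumes \<alpha>: "\<alpha> \<noteq> 0" "\<alpha> ^ (q + 1) \<noteq> 1" and x: "x \<in> hermitian_hull q C" "x $ j \<noteq> 0"
  shows "hermitian_hull q (scale_coord j \<alpha> ` C) = {z \<in> hermitian_hull q C. z $ j = 0}"
proof (intro equalityI subsetI)
  have fix_scale: "scale_coord j \<alpha> z = z" if "z $ j = 0" for z :: "'a ^ 'n"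
    using that by (simp add: scale_coord_def vec_eq_iff)
  fix z assume "z \<in> hermitian_hull q (scale_coord j \<alpha> ` C)"
  then obtain u where u: "u \<in> C" "z = scale_coord j \<alpha> u"
    "\<And>y. y \<in> C \<Longrightarrow> herm u y + (\<alpha> ^ (q + 1) - 1) * u $ j * (y $ j) ^ q = 0"
    by (auto simp: hermitian_hull_eq herm_scale_coord)
  have "herm u x = 0" "x \<in> C" using x(1) u(1) herm_swap_0 by (auto simp: hermitian_hull_eq)
  then have "u $ j = 0" using u(3)[of x] \<alpha> x(2) by simp
  then show "z \<in> {z \<in> hermitian_hull q C. z $ j = 0}"
    using u fix_scale by (auto simp: hermitian_hull_eq)
next
  fix z assume "z \<in> {z \<in> hermitian_hull q C. z $ j = 0}"
  moreover from this have "scale_coord j \<alpha> z = z" by (simp add: scale_coord_def vec_eq_iff)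
  ultimately show "z \<in> hermitian_hull q (scale_coord j \<alpha> ` C)"
    using herm_scale_coord[of j \<alpha> z] by (auto simp: hermitian_hull_eq image_iff) metis
qed

text \<open>A nonzero hull has a vector with a nonzero entry \<open>j\<close>. Rescaling there cuts
  out the kernel of the j-th coordinate: at most one dimension is lost, and at least one because
  that vector drops out.\<close>

lemma grs_hull_reduce_step:
  fixes C :: "('a ^ 'n::finite) set"
  assumes "q > 2" "grs_code k C" "vec.dim (hermitian_hull q C) = Suc r"
  shows "\<exists>C' :: ('a ^ 'n) set. grs_code k C' \<and> vec.dim (hermitian_hull q C') = r"
proof -
  let ?H = "hermitian_hull q C"
  have sub: "vec.subspace ?H" by (rule hermitian_hull_subspace[OF grs_code_subspace[OF assms(2)]])
  have cH: "card ?H = CARD('a) ^ Suc r" using card_vec_subspace[OF sub] assms(3) by simp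
  then have "\<not> ?H \<subseteq> {0}"
    using card_mono[of "{0}" ?H] card_gt_1_field[where 'a='a] one_less_power[of "CARD('a)" "Suc r"]
    by fastforce
  then obtain x j where x: "x \<in> ?H" "x $ j \<noteq> 0"
    by (metis insertCI subsetI vec_eq_iff zero_index)
  obtain \<alpha> :: 'a where \<alpha>: "\<alpha> \<noteq> 0" "\<alpha> ^ (q + 1) \<noteq> 1" using exists_norm_neq_1[OF assms(1)] by blast
  let ?C' = "scale_coord j \<alpha> ` C"
  have C': "grs_code k ?C'" by (rule grs_code_scale[OF assms(2) \<alpha>(1)])
  have H': "hermitian_hull q ?C' = {z \<in> ?H. z $ j = 0}" by (rule hull_scale_coord[OF \<alpha> x])
  have sub': "vec.subspace (hermitian_hull q ?C')"
    by (rule hermitian_hull_subspace[OF grs_code_subspace[OF C']])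
  have "card ?H \<le> CARD('a) * card (hermitian_hull q ?C')"
    unfolding H' by (rule card_kernel[OF sub]) simp
  then have "Suc r \<le> vec.dim (hermitian_hull q ?C') + 1" using dim_le_Suc[OF sub sub'] assms(3) by simp
  moreover have "card (hermitian_hull q ?C') < card ?H"
    unfolding H' using x by (intro psubset_card_mono) auto
  then have "vec.dim (hermitian_hull q ?C') < Suc r"
    using card_vec_subspace[OF sub'] cH card_gt_1_field[where 'a='a] by (simp only: power_strict_increasing_iff)
  ultimately show ?thesis using C' by (intro exI[of _ ?C']) auto
qed

lemma grs_hull_reduce:
  fixes C :: "('a ^ 'n::finite) set"
  assumes "q > 2" "grs_code k C" "s \<le> vec.dim (hermitian_hull q C)"
  shows "\<exists>C' :: ('a ^ 'n) set. grs_code k C' \<and> vec.dim (hermitian_hull q C') = s"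
  using assms(3,2)
proof (induction "vec.dim (hermitian_hull q C)" arbitrary: C)
  case (Suc r)
  show ?case
  proof (cases "s = Suc r")
    case False
    obtain C' :: "('a ^ 'n) set" where "grs_code k C'" "vec.dim (hermitian_hull q C') = r"
      using grs_hull_reduce_step[OF assms(1) Suc.prems(2) Suc.hyps(2)[symmetric]] by blast
    then show ?thesis using Suc.hyps(1)[of C'] Suc.prems(1) Suc.hyps(2) False by auto
  qed (use Suc in auto)
qed (metis le_zero_eq)

text \<open>With value -1, the appended entries contribute squares of opposite sign to the form and
  so cancel it on the span of the system.\<close>

definition anti_orthonormal :: "('a ^ 'n::finite) set \<Rightarrow> nat \<Rightarrow> (nat \<Rightarrow> 'a ^ 'n) \<Rightarrow> bool" where
  "anti_orthonormal C c e \<longleftrightarrow> (\<forall>i<c. e i \<in> C) \<and>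
     (\<forall>i<c. \<forall>j<c. herm (e i) (e j) = (if i = j then -1 else 0))"

text \<open>If conjugation were negation, then 1 = -1 from z = 1, hence \<open>w\<close> would be
  fixed by conjugation and lie in \<open>Fq\<close>.\<close>

lemma trace_nonzero: "\<exists>z::'a. z + z ^ q \<noteq> 0"
proof (rule ccontr)
  assume "\<not> (\<exists>z::'a. z + z ^ q \<noteq> 0)"
  then have neg: "z ^ q = - z" for z :: 'a by (simp add: eq_neg_iff_add_eq_0 add.commute)
  then have "- w = w" using neg[of 1] by (metis mult_minus1 mult_1 power_one)
  then show False using conj_w_neq neg[of w] by simp
qed

text \<open>Polarisation: if \<open>u\<close> and \<open>v\<close> are isotropic, the form at u + t
  v is a trace, and \<open>t\<close> can be chosen to make that trace nonzero.\<close>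

lemma exists_anisotropic:
  assumes "vec.subspace (C :: ('a ^ 'n::finite) set)" "u \<in> C" "v \<in> C" "herm u v \<noteq> 0"
  shows "\<exists>z\<in>C. herm z z \<noteq> 0"
proof (cases "herm u u = 0 \<and> herm v v = 0")
  case True
  obtain z :: 'a where z: "z + z ^ q \<noteq> 0" using trace_nonzero by blast
  \<comment> \<open>Chosen so that t^q times \<open>herm u v\<close> is \<open>z\<close>; the other
    cross term is then its conjugate.\<close>
  define t where "t = (z / herm u v) ^ q"
  have "t ^ q * herm u v = z" using assms(4) by (simp add: t_def)
  moreover have "t * herm v u = z ^ q"
    using calculation by (metis conj_conj herm_conj power_mult_distrib)
  ultimately have "herm (u + t *s v) (u + t *s v) = z + z ^ q"
    using True by (simp add: herm_add_left herm_add_right herm_scale_left herm_scale_right)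
  then show ?thesis
    using z assms vec.subspace_add vec.subspace_scale by metis
qed (use assms in auto)

text \<open>The projection \<open>x + (\<Sum>j<c. herm x (e j) *s e j)\<close> is orthogonal to the system, and on its image
  the form is the residual form; a maximal system therefore has zero residual form.\<close>

lemma maximal_anti_orthonormal:
  fixes C :: "('a ^ 'n::finite) set"
  assumes C: "vec.subspace C"
  shows "\<exists>c e. anti_orthonormal C c e \<and>
     (\<forall>x\<in>C. \<forall>y\<in>C. herm x y + (\<Sum>j<c. herm x (e j) * herm y (e j) ^ q) = 0)"
proof -
  let ?A = "\<lambda>c. \<exists>e. anti_orthonormal C c e"
  have "?A 0" by (simp add: anti_orthonormal_def)
  \<comment> \<open>The vectors of a system are pairwise distinct, so lengths are bounded and a
    longest system exists.\<close>
  moreover have "\<forall>c. ?A c \<longrightarrow> c \<le> card C"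
  proof safe
    fix c e assume e: "anti_orthonormal C c e"
    have "inj_on e {..<c}"
    proof (rule inj_onI, rule ccontr)
      fix i j assume ij: "i \<in> {..<c}" "j \<in> {..<c}" "e i = e j" "i \<noteq> j"
      then have "herm (e i) (e i) = -1" "herm (e i) (e j) = 0"
        using e unfolding anti_orthonormal_def by (metis lessThan_iff)+
      then show False using ij(3) by simp
    qed
    moreover have "e ` {..<c} \<subseteq> C" using e by (auto simp: anti_orthonormal_def)
    ultimately show "c \<le> card C" using card_inj_on_le[of e "{..<c}" C] by simp
  qed
  ultimately obtain c where c: "?A c" "\<And>d. ?A d \<Longrightarrow> d \<le> c"
    using Greatest_le_nat[of ?A] GreatestI_nat[of ?A] by (metis (no_types, lifting))
  then obtain e where e: "anti_orthonormal C c e" by auto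
  define \<pi> where "\<pi> x = x + (\<Sum>j<c. herm x (e j) *s e j)" for x
  have eC: "j < c \<Longrightarrow> e j \<in> C" for j using e by (auto simp: anti_orthonormal_def)
  have \<pi>C: "\<pi> x \<in> C" if "x \<in> C" for x
    unfolding \<pi>_def using that eC C by (intro vec.subspace_add vec.subspace_sum vec.subspace_scale) auto
  have \<pi>_e: "herm (\<pi> x) (e i) = 0" if "i < c" for x i
  proof -
    have "herm (\<pi> x) (e i) = herm x (e i) + (\<Sum>j<c. herm x (e j) * herm (e j) (e i))"
      by (simp add: \<pi>_def herm_add_left herm_sum_left herm_scale_left)
    also have "(\<Sum>j<c. herm x (e j) * herm (e j) (e i)) = (\<Sum>j<c. if j = i then - herm x (e i) else 0)"
      using e that by (intro sum.cong) (auto simp: anti_orthonormal_def)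
    finally show ?thesis using that by simp
  qed
  have \<pi>_res: "herm (\<pi> x) y = herm x y + (\<Sum>j<c. herm x (e j) * herm y (e j) ^ q)" for x y
    by (simp add: \<pi>_def herm_add_left herm_sum_left herm_scale_left herm_conj)
  have \<pi>_\<pi>: "herm (\<pi> x) (\<pi> y) = herm (\<pi> x) y" for x y
  proof -
    have "herm (\<pi> x) (\<pi> y) = herm (\<pi> x) y + (\<Sum>j<c. herm y (e j) ^ q * herm (\<pi> x) (e j))"
      by (subst (2) \<pi>_def) (simp add: herm_add_right herm_sum_right herm_scale_right)
    also have "(\<Sum>j<c. herm y (e j) ^ q * herm (\<pi> x) (e j)) = 0"
      by (intro sum.neutral) (simp add: \<pi>_e)
    finally show ?thesis by simp
  qed
  have "herm x y + (\<Sum>j<c. herm x (e j) * herm y (e j) ^ q) = 0" if xy: "x \<in> C" "y \<in> C" for x y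
  proof (rule ccontr)
    \<comment> \<open>The residual form lives on the orthogonal complement of the system inside
      \<open>C\<close>; an anisotropic vector there would lengthen the system.\<close>
    let ?D = "{z\<in>C. \<forall>j<c. herm z (e j) = 0}"
    assume "\<not> ?thesis"
    then have "herm (\<pi> x) (\<pi> y) \<noteq> 0" by (subst \<pi>_\<pi>) (simp only: \<pi>_res not_False_eq_True)
    moreover have "vec.subspace ?D"
      using vec.subspace_0[OF C] vec.subspace_add[OF C] vec.subspace_scale[OF C]
      by (auto simp: herm_add_left herm_scale_left intro!: vec.subspaceI)
    ultimately obtain z where z: "z \<in> ?D" "herm z z \<noteq> 0"
      using exists_anisotropic[of ?D "\<pi> x" "\<pi> y"] \<pi>C xy \<pi>_e by auto
    \<comment> \<open>Lying in \<open>Fq\<close>, this value is a norm, so \<open>z\<close> can be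
      rescaled to have form value -1.\<close>
    have "- 1 / herm z z \<in> Fq" by (simp add: Fq_def power_divide conj_minus herm_conj)
    then obtain \<mu> where \<mu>: "\<mu> ^ (q + 1) = - 1 / herm z z" using norm_surj by metis
    have norm: "herm (\<mu> *s z) (\<mu> *s z) = - 1"
    proof -
      have "herm (\<mu> *s z) (\<mu> *s z) = \<mu> ^ (q + 1) * herm z z"
        by (simp add: herm_scale_left herm_scale_right mult_ac)
      then show ?thesis using \<mu> z(2) by simp
    qed
    have orth: "herm (\<mu> *s z) (e j) = 0" "herm (e j) (\<mu> *s z) = 0" if "j < c" for j
      using z(1) that herm_swap_0[of z "e j"] by (auto simp: herm_scale_left herm_scale_right)
    have "\<mu> *s z \<in> C" using z(1) vec.subspace_scale[OF C] by auto
    then have "anti_orthonormal C (Suc c) (e(c := \<mu> *s z))"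
      using e norm orth by (auto simp: anti_orthonormal_def less_Suc_eq)
    then show False using c(2)[of "Suc c"] by auto
  qed
  then show ?thesis using e by blast
qed

text \<open>A codeword is determined by its projection, which lies in the hull because the residual
  form is zero, and by its \<open>c\<close> products with the system, which are arbitrary. This
  count fixes \<open>c\<close>.\<close>

lemma card_hull_anti_orthonormal:
  fixes C :: "('a ^ 'n::finite) set"
  assumes C: "vec.subspace C" and e: "anti_orthonormal C c e"
    and res: "\<forall>x\<in>C. \<forall>y\<in>C. herm x y + (\<Sum>j<c. herm x (e j) * herm y (e j) ^ q) = 0"
  shows "card C = card (hermitian_hull q C) * CARD('a) ^ c"
proof -
  let ?H = "hermitian_hull q C" and ?F = "PiE {..<c} (\<lambda>_. UNIV :: 'a set)"
  define f where "f x = (x + (\<Sum>j<c. herm x (e j) *s e j), restrict (\<lambda>j. herm x (e j)) {..<c})" for x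
  define g where "g zt = fst zt - (\<Sum>j<c. snd zt j *s e j)" for zt :: "('a ^ 'n) \<times> (nat \<Rightarrow> 'a)"
  have eC: "j < c \<Longrightarrow> e j \<in> C" for j using e by (auto simp: anti_orthonormal_def)
  have sumC: "(\<Sum>j<c. t j *s e j) \<in> C" for t :: "nat \<Rightarrow> 'a"
    using eC C by (intro vec.subspace_sum vec.subspace_scale) auto
  have g_e: "herm (g (z, t)) (e i) = t i" if "z \<in> ?H" "i < c" for z t i
  proof -
    have "herm (g (z, t)) (e i) = herm z (e i) - (\<Sum>j<c. t j * herm (e j) (e i))"
      by (simp add: g_def herm_diff_left herm_sum_left herm_scale_left)
    also have "(\<Sum>j<c. t j * herm (e j) (e i)) = (\<Sum>j<c. if j = i then - t i else 0)"
      using e that(2) by (intro sum.cong) (auto simp: anti_orthonormal_def)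
    finally show ?thesis using that eC by (simp add: hermitian_hull_eq)
  qed
  have "bij_betw f C (?H \<times> ?F)"
  proof (rule bij_betwI[where g = g])
    show "f \<in> C \<rightarrow> ?H \<times> ?F"
    proof
      fix x assume x: "x \<in> C"
      have "herm (x + (\<Sum>j<c. herm x (e j) *s e j)) y = 0" if "y \<in> C" for y
        using res x that by (simp add: herm_add_left herm_sum_left herm_scale_left herm_conj)
      then show "f x \<in> ?H \<times> ?F"
        using x vec.subspace_add[OF C x sumC] by (auto simp: f_def hermitian_hull_eq)
    qed
    show "g \<in> ?H \<times> ?F \<rightarrow> C"
      using sumC vec.subspace_diff[OF C] by (auto simp: g_def hermitian_hull_eq)
    show "g (f x) = x" for x by (simp add: f_def g_def)
    fix zt assume "zt \<in> ?H \<times> ?F"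
    then obtain z t where zt: "zt = (z, t)" "z \<in> ?H" "t \<in> ?F" by auto
    have "restrict (\<lambda>j. herm (g (z, t)) (e j)) {..<c} = t"
      using zt by (intro ext) (auto simp: g_e PiE_def extensional_def)
    moreover have "(\<Sum>j<c. herm (g (z, t)) (e j) *s e j) = (\<Sum>j<c. t j *s e j)"
      using zt by (intro sum.cong) (auto simp: g_e)
    ultimately show "f (g zt) = zt" by (simp add: f_def zt(1)) (simp add: g_def)
  qed
  then have "card C = card ?H * card ?F" by (metis bij_betw_same_card card_cartesian_product)
  then show ?thesis by (simp add: card_PiE)
qed

end

section \<open>Stabiliser codes of extended Hermitian codes\<close>

lemma sum_lessThan_add:
  fixes f :: "nat \<Rightarrow> 'a::comm_monoid_add"
  shows "(\<Sum>j<n + c. f j) = (\<Sum>j<n. f j) + (\<Sum>i<c. f (n + i))"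
  by (induction c) (auto simp: add.assoc)

lemma nths_eq_iff:
  assumes "length v = length w"
  shows "nths v A = nths w A \<longleftrightarrow> (\<forall>j\<in>A. j < length v \<longrightarrow> v ! j = w ! j)"
  using assms
proof (induction v w arbitrary: A rule: list_induct2)
  case (Cons x xs y ys)
  have split: "(\<forall>j\<in>A. j < Suc (length xs) \<longrightarrow> (x # xs) ! j = (y # ys) ! j) \<longleftrightarrow>
    (0 \<in> A \<longrightarrow> x = y) \<and> (\<forall>j\<in>{j. Suc j \<in> A}. j < length xs \<longrightarrow> xs ! j = ys ! j)"
    (is "?l \<longleftrightarrow> ?r")
  proof
    assume ?l
    then show ?r by (metis Suc_less_eq mem_Collect_eq nth_Cons_0 nth_Cons_Suc zero_less_Suc)
  next
    assume ?r
    then show ?l by (auto simp: nth_Cons split: nat.split)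
  qed
  show ?case
    unfolding list.size(4) add_Suc_right add_0_right split nths_Cons Cons.IH[symmetric] by auto
qed auto

lemma op_mult_reindex:
  assumes "bij_betw \<Phi> B X"
  shows "op_mult B (\<lambda>x y. A (\<Phi> x) (\<Phi> y)) (\<lambda>x y. A' (\<Phi> x) (\<Phi> y)) x z = op_mult X A A' (\<Phi> x) (\<Phi> z)"
  unfolding op_mult_def using sum.reindex_bij_betw[OF assms, of "\<lambda>y. A (\<Phi> x) y * A' y (\<Phi> z)"] .

section \<open>Characters, words over the subfield, and local operators\<close>

context quadratic_extension
begin

text \<open>Nontriviality at 1, and not merely somewhere in the large field, keeps the character
  nontrivial on \<open>Fq\<close>.\<close>

definition psi :: "'a \<Rightarrow> complex" where
  "psi = (SOME \<psi>. (\<forall>x y. \<psi> (x + y) = \<psi> x * \<psi> y) \<and> (\<forall>x. norm (\<psi> x) = 1) \<and> \<psi> 1 \<noteq> 1)"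

lemma psi_add: "psi (x + y) = psi x * psi y" and psi_norm: "norm (psi x) = 1" and psi_1: "psi 1 \<noteq> 1"
  using someI_ex[OF additive_character_exists[where 'a='a]] unfolding psi_def by blast+

lemma psi_eq_iff: "psi x = psi y \<longleftrightarrow> psi (x - y) = 1"
proof -
  have "psi x = psi (x - y) * psi y" by (simp flip: psi_add)
  moreover have "psi y \<noteq> 0" using psi_norm[of y] by auto
  ultimately show ?thesis by auto
qed

text \<open>Words are functions, extended by zero, so that pointwise addition supplies the group
  structure required by \<open>weyl\<close>.\<close>

definition wordspace :: "nat \<Rightarrow> (nat \<Rightarrow> 'a) set" where
  "wordspace m = {u. (\<forall>j<m. u j \<in> Fq) \<and> (\<forall>j\<ge>m. u j = 0)}"

definition pairing :: "nat \<Rightarrow> (nat \<Rightarrow> 'a) \<Rightarrow> (nat \<Rightarrow> 'a) \<Rightarrow> complex" where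
  "pairing m b x = psi (\<Sum>j<m. b j * x j)"

lemma wordspace_eqI:
  "u \<in> wordspace m \<Longrightarrow> v \<in> wordspace m \<Longrightarrow> (\<And>j. j < m \<Longrightarrow> u j = v j) \<Longrightarrow> u = v"
  by (rule ext) (metis (mono_tags, lifting) mem_Collect_eq not_le_imp_less wordspace_def)

lemma finite_wordspace: "finite (wordspace m)"
proof (rule finite_imageD)
  let ?f = "\<lambda>u. restrict u {..<m}"
  show "finite (?f ` wordspace m)"
    by (rule finite_subset[of _ "PiE {..<m} (\<lambda>_. UNIV)"]) (auto simp: finite_PiE split: if_splits)
  show "inj_on ?f (wordspace m)"
    by (rule inj_onI) (metis lessThan_iff restrict_apply wordspace_eqI)
qed

lemma single_in_wordspace: "j < m \<Longrightarrow> t \<in> Fq \<Longrightarrow> (\<lambda>i. if i = j then t else 0) \<in> wordspace m"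
  using Fq_closed(1) by (auto simp: wordspace_def)

lemma pairing_single: "j < m \<Longrightarrow> pairing m b (\<lambda>i. if i = j then t else 0) = psi (b j * t)"
  by (simp add: pairing_def if_distrib cong: if_cong)

lemma weyl_wordspace: "weyl (wordspace m) (pairing m)"
proof
  show "finite (wordspace m)" by (rule finite_wordspace)
  show "subgrp (wordspace m)" by (auto simp: subgrp_def wordspace_def)
  show "sym_bichar (pairing m) (wordspace m)"
    by (auto simp: sym_bichar_def pairing_def psi_norm mult.commute algebra_simps sum.distrib psi_add)
  fix x :: "nat \<Rightarrow> 'a" assume x: "x \<in> wordspace m" "x \<noteq> 0"
  then obtain j where j: "j < m" "x j \<noteq> 0" using wordspace_eqI[of x m 0] by (auto simp: wordspace_def)
  \<comment> \<open>A single entry, inverse to \<open>x j\<close>, makes the pairing equal to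
    \<open>psi 1\<close>.\<close>
  let ?y = "\<lambda>i. if i = j then inverse (x j) else 0"
  have "x j \<in> Fq" using x j by (auto simp: wordspace_def)
  then have "?y \<in> wordspace m" using single_in_wordspace[OF j(1)] by blast
  moreover have "pairing m ?y x = psi 1"
    using pairing_single[OF j(1), of x "inverse (x j)"] j by (simp add: pairing_def mult.commute)
  ultimately show "\<exists>y\<in>wordspace m. pairing m y x \<noteq> 1" using psi_1 by metis
qed

text \<open>\<open>E\<close> is the tensor product of an operator on the positions in \<open>S\<close> with the identity on the
  remaining positions below \<open>m\<close>.\<close>

definition local_on :: "nat \<Rightarrow> nat set \<Rightarrow> ((nat \<Rightarrow> 'a) \<Rightarrow> (nat \<Rightarrow> 'a) \<Rightarrow> complex) \<Rightarrow> bool" where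
  "local_on m S E \<longleftrightarrow> (\<exists>H.
     (\<forall>u\<in>wordspace m. \<forall>v\<in>wordspace m.
        E u v = (if \<forall>j\<in>{..<m} - S. u j = v j then H u v else 0)) \<and>
     (\<forall>u\<in>wordspace m. \<forall>v\<in>wordspace m. \<forall>u'\<in>wordspace m. \<forall>v'\<in>wordspace m.
        (\<forall>j\<in>S. u j = u' j \<and> v j = v' j) \<longrightarrow> H u v = H u' v'))"

text \<open>A shift at a position outside \<open>S\<close> meets only zero entries of
  \<open>E\<close>. A phase at such a position is excluded because \<open>E\<close> is invariant
  under translation there.\<close>

lemma coef_local:
  assumes E: "local_on m S E" and ab: "a \<in> wordspace m" "b \<in> wordspace m"
    and nz: "weyl.coef (wordspace m) (pairing m) E (a, b) \<noteq> 0" and j: "j \<notin> S"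
  shows "a j = 0 \<and> b j = 0"
proof (cases "j < m")
  case True
  interpret weyl "wordspace m" "pairing m" by (rule weyl_wordspace)
  obtain H where H': "\<forall>u\<in>wordspace m. \<forall>v\<in>wordspace m.
        E u v = (if \<forall>j\<in>{..<m} - S. u j = v j then H u v else 0)"
    and H: "\<forall>u\<in>wordspace m. \<forall>v\<in>wordspace m. \<forall>u'\<in>wordspace m. \<forall>v'\<in>wordspace m.
        (\<forall>j\<in>S. u j = u' j \<and> v j = v' j) \<longrightarrow> H u v = H u' v'"
    using E unfolding local_on_def by (elim exE conjE)
  have E_eq: "E u v = (if \<forall>j\<in>{..<m} - S. u j = v j then H u v else 0)"
    if "u \<in> wordspace m" "v \<in> wordspace m" for u v
    using H' that by blast
  have "a j = 0"
  proof (rule ccontr)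
    assume "a j \<noteq> 0"
    then have "E (t + a) t = 0" if "t \<in> wordspace m" for t
      using E_eq[of "t + a" t] X_closed(4) that ab j True by auto
    then show False using nz by (simp add: coef_def)
  qed
  moreover have "b j = 0"
  proof (rule ccontr)
    assume bj: "b j \<noteq> 0"
    let ?u = "\<lambda>i. if i = j then inverse (b j) else 0"
    have "b j \<in> Fq" using ab True by (auto simp: wordspace_def)
    then have u: "?u \<in> wordspace m" using single_in_wordspace[OF True] by blast
    have "coef E (a, b) = 0"
    proof (rule coef_eq_0_shift[OF u ab(2)])
      show "pairing m b ?u \<noteq> 1" using pairing_single[OF True] bj psi_1 by simp
      fix t assume t: "t \<in> wordspace m"
      have "H (t + ?u + a) (t + ?u) = H (t + a) t"
        using t u ab j by (intro H[rule_format]) (auto simp: X_closed)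
      then show "E (t + ?u + a) (t + ?u) = E (t + a) t"
        using t u ab E_eq[of "t + ?u + a" "t + ?u"] E_eq[of "t + a" t] by (simp add: X_closed)
    qed
    then show False using nz by blast
  qed
  ultimately show ?thesis by blast
qed (use ab in \<open>auto simp: wordspace_def\<close>)

end

locale extended_code = quadratic_extension q ty
  for q and ty :: "'a::{field,finite} itself" +
  fixes C :: "('a ^ 'n::finite) set" and K c n :: nat and e :: "nat \<Rightarrow> 'a ^ 'n" and \<pi> :: "nat \<Rightarrow> 'n"
    and enc :: "nat \<Rightarrow> 'a"
  assumes grs: "grs_code K C" and orthonormal: "anti_orthonormal C c e"
    and residual: "\<forall>x\<in>C. \<forall>y\<in>C. herm x y + (\<Sum>j<c. herm x (e j) * herm y (e j) ^ q) = 0"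
    and \<pi>: "bij_betw \<pi> {..<n} UNIV" and enc: "bij_betw enc {..<q} Fq"
begin

definition lift :: "'a ^ 'n \<Rightarrow> nat \<Rightarrow> 'a" where
  "lift x j = (if j < n then x $ \<pi> j else if j < n + c then herm x (e (j - n)) else 0)"

definition form :: "'a ^ 'n \<Rightarrow> (nat \<Rightarrow> 'a) \<Rightarrow> 'a" where
  "form x z = (\<Sum>j<n + c. lift x j * z j ^ q)"

lemma form_split: "form x z = (\<Sum>j<n. x $ \<pi> j * z j ^ q) + (\<Sum>i<c. herm x (e i) * z (n + i) ^ q)"
  by (simp add: form_def sum_lessThan_add lift_def)

lemma form_lift_0:
  assumes "x \<in> C" "y \<in> C" shows "form x (lift y) = 0"
proof -
  have "(\<Sum>j<n. x $ \<pi> j * y $ \<pi> j ^ q) = herm x y"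
    unfolding herm_def using sum.reindex_bij_betw[OF \<pi>, of "\<lambda>i. x $ i * y $ i ^ q"] .
  then show ?thesis using residual assms by (simp add: form_split lift_def)
qed

text \<open>The Weyl label of an extended codeword: coordinates along 1 are shifts, coordinates
  along \<open>w\<close> are phases.\<close>

definition coords_pair :: "'a ^ 'n \<Rightarrow> (nat \<Rightarrow> 'a) \<times> (nat \<Rightarrow> 'a)" where
  "coords_pair x = (\<lambda>j. fst_coord (lift x j), \<lambda>j. snd_coord (lift x j))"

abbreviation "X \<equiv> wordspace (n + c)"
abbreviation "pr \<equiv> pairing (n + c)"

sublocale W: weyl X pr by (rule weyl_wordspace)

lemma coords_pair_in: "coords_pair x \<in> X \<times> X"
  by (auto simp: coords_pair_def wordspace_def fst_coord_Fq snd_coord_Fq lift_def)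

text \<open>The argument of \<open>psi\<close> is \<open>snd_coord\<close> of the Hermitian product;
  it arises by summing \<open>symplectic_hermitian\<close> over the positions.\<close>

lemma cocycle_eq_iff:
  assumes "a \<in> X" "b \<in> X"
  shows "W.cocycle (coords_pair x) (a, b) = W.cocycle (a, b) (coords_pair x) \<longleftrightarrow>
    psi ((form x (\<lambda>j. a j + b j * w) - form x (\<lambda>j. a j + b j * w) ^ q) / (w - w ^ q)) = 1"
proof -
  let ?z = "\<lambda>j. a j + b j * w"
  have "(\<Sum>j<n + c. snd_coord (lift x j) * a j) - (\<Sum>j<n + c. b j * fst_coord (lift x j))
    = (\<Sum>j<n + c. (lift x j * ?z j ^ q - lift x j ^ q * ?z j) / (w - w ^ q))"
    unfolding sum_subtractf[symmetric]
  proof (intro sum.cong refl)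
    fix j assume "j \<in> {..<n + c}"
    then have "fst_coord (?z j) = a j" "snd_coord (?z j) = b j"
      using assms by (auto simp: wordspace_def coords_unique)
    then show "snd_coord (lift x j) * a j - b j * fst_coord (lift x j)
      = (lift x j * ?z j ^ q - lift x j ^ q * ?z j) / (w - w ^ q)"
      using symplectic_hermitian[of "?z j" "lift x j"] by (simp add: mult.commute)
  qed
  also have "\<dots> = (form x ?z - form x ?z ^ q) / (w - w ^ q)"
    by (simp add: form_def conj_sum power_mult_distrib sum_subtractf flip: sum_divide_distrib)
  finally show ?thesis
    by (simp add: W.cocycle_def coords_pair_def pairing_def psi_eq_iff)
qed

lemma lift_diff: "lift (x - y) j = lift x j - lift y j"
  and lift_scale: "lift (t *s x) j = t * lift x j"
  by (auto simp: lift_def herm_diff_left herm_scale_left)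

lemma lift_inj: "lift x = lift y \<Longrightarrow> x = y"
proof -
  assume eq: "lift x = lift y"
  have "x $ i = y $ i" for i
  proof -
    obtain j where "j < n" "i = \<pi> j" using \<pi> by (auto simp: bij_betw_def)
    then show ?thesis using fun_cong[OF eq, of j] by (simp add: lift_def)
  qed
  then show ?thesis by (simp add: vec_eq_iff)
qed

lemma coords_pair_diff: "coords_pair (x - y) = coords_pair x - coords_pair y"
proof -
  have "fst_coord (s - t) = fst_coord s - fst_coord t" "snd_coord (s - t) = snd_coord s - snd_coord t" for s t
    using fst_coord_add[of s "- t"] snd_coord_add[of s "- t"] by (simp_all add: fst_coord_minus snd_coord_minus)
  then show ?thesis by (simp add: coords_pair_def lift_diff fun_eq_iff minus_prod_def)
qed

lemma coords_pair_inj: "inj coords_pair"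
proof (rule injI)
  fix x y assume eq: "coords_pair x = coords_pair y"
  have "fst_coord (lift x j) = fst_coord (lift y j)" "snd_coord (lift x j) = snd_coord (lift y j)" for j
    using fun_cong[OF arg_cong[OF eq, of fst], of j] fun_cong[OF arg_cong[OF eq, of snd], of j]
    by (simp_all add: coords_pair_def)
  then have "lift x j = lift y j" for j by (rule coords_inj)
  then have "lift x = lift y" by (rule ext)
  then show "x = y" by (rule lift_inj)
qed

lemma subspace_C: "vec.subspace C" by (rule grs_code_subspace[OF grs])

sublocale I: isotropic X pr "coords_pair ` C"
proof
  have 0: "coords_pair 0 = 0" using coords_pair_diff[of 0 0] by simp
  show "subgrp (coords_pair ` C)"
    unfolding subgrp_def
    using vec.subspace_0[OF subspace_C] vec.subspace_diff[OF subspace_C] 0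
    by (auto simp flip: coords_pair_diff intro: rev_image_eqI)
  show "coords_pair ` C \<subseteq> X \<times> X" using coords_pair_in by blast
  fix g h assume "g \<in> coords_pair ` C" "h \<in> coords_pair ` C"
  then obtain x y where xy: "x \<in> C" "y \<in> C" "g = coords_pair x" "h = coords_pair y" by auto
  obtain a b where ab: "h = (a, b)" by (cases h)
  then have "(\<lambda>j. a j + b j * w) = lift y"
    using xy(4) by (auto simp: coords_pair_def coords)
  then have "form x (\<lambda>j. a j + b j * w) = 0" using form_lift_0 xy by simp
  moreover have "a \<in> X" "b \<in> X" using coords_pair_in[of y] xy(4) ab by auto
  moreover have "psi 0 = 1" using psi_eq_iff[of 0 0] by simp
  ultimately show "W.cocycle g h = W.cocycle h g"
    using cocycle_eq_iff[of a b x] xy(3) ab by simp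
qed

text \<open>Multiplying \<open>x\<close> by a scalar moves the value of the form to \<open>w\<close>, where the character
  is not trivial.\<close>

lemma noncommuting:
  assumes x: "x \<in> C" and ab: "a \<in> X" "b \<in> X" and f: "form x (\<lambda>j. a j + b j * w) \<noteq> 0"
  shows "\<exists>g\<in>coords_pair ` C. W.cocycle g (a, b) \<noteq> W.cocycle (a, b) g"
proof -
  define t where "t = w / form x (\<lambda>j. a j + b j * w)"
  have "form (t *s x) (\<lambda>j. a j + b j * w) = t * form x (\<lambda>j. a j + b j * w)"
    by (simp add: form_def lift_scale sum_distrib_left mult.assoc)
  also have "\<dots> = w" using f by (simp add: t_def)
  finally have "W.cocycle (coords_pair (t *s x)) (a, b) \<noteq> W.cocycle (a, b) (coords_pair (t *s x))"
    using cocycle_eq_iff[OF ab, of "t *s x"] psi_1 conj_w_neq by simp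
  then show ?thesis using vec.subspace_scale[OF subspace_C x] by blast
qed

lemma local_noncommuting:
  assumes S: "S \<subseteq> {..<n} \<and> card S \<le> K \<or> S \<subseteq> {n..<n + c}"
    and ab: "a \<in> X" "b \<in> X" "(a, b) \<noteq> 0" and supp: "\<And>j. j \<notin> S \<Longrightarrow> a j = 0 \<and> b j = 0"
  shows "\<exists>g\<in>coords_pair ` C. W.cocycle g (a, b) \<noteq> W.cocycle (a, b) g"
proof -
  let ?z = "\<lambda>j. a j + b j * w"
  \<comment> \<open>Uniqueness of coordinates turns a nonzero label into a nonzero entry over the
    large field, and the support condition puts it in \<open>S\<close>.\<close>
  have "\<exists>j\<in>S. ?z j \<noteq> 0"
  proof (rule ccontr)
    assume "\<not> (\<exists>j\<in>S. ?z j \<noteq> 0)"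
    then have z0: "?z j = 0" for j using supp[of j] by (cases "j \<in> S") auto
    have "a j \<in> Fq" "b j \<in> Fq" for j
      using ab Fq_closed(1) by (cases "j < n + c"; auto simp: wordspace_def)+
    then have "a j = 0 \<and> b j = 0" for j
      using coords_unique[of "a j" "b j"] z0[of j] by simp
    then have "(a, b) = 0" by (auto simp: zero_prod_def fun_eq_iff)
    then show False using ab(3) by blast
  qed
  then obtain j0 where j0: "j0 \<in> S" "?z j0 \<noteq> 0" by blast
  have z_supp: "?z j = 0" if "j \<notin> S" for j using supp[OF that] by simp
  have "\<exists>x\<in>C. form x ?z \<noteq> 0"
    using S
  proof
    assume S: "S \<subseteq> {..<n} \<and> card S \<le> K"
    have inj: "inj_on \<pi> {..<n}" using \<pi> by (simp add: bij_betw_def)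
    have "card (\<pi> ` S) \<le> K" using S card_image_le[of S \<pi>] finite_subset[of S "{..<n}"] by auto
    \<comment> \<open>A codeword that meets the error in the single position \<open>j0\<close>, so
      the form reduces to one nonzero term.\<close>
    then obtain x where x: "x \<in> C" "x $ \<pi> j0 \<noteq> 0" "\<forall>i\<in>\<pi> ` S - {\<pi> j0}. x $ i = 0"
      using grs_code_interpolate[OF grs, of "\<pi> ` S" "\<pi> j0"] j0(1) by blast
    have "(\<Sum>j<n. x $ \<pi> j * ?z j ^ q) = (\<Sum>j<n. if j = j0 then x $ \<pi> j0 * ?z j0 ^ q else 0)"
    proof (intro sum.cong refl)
      fix j assume "j \<in> {..<n}"
      show "x $ \<pi> j * ?z j ^ q = (if j = j0 then x $ \<pi> j0 * ?z j0 ^ q else 0)"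
      proof (cases "j \<in> S \<and> j \<noteq> j0")
        case True
        then have "\<pi> j \<noteq> \<pi> j0" using inj S j0(1) by (auto simp: inj_on_def)
        then show ?thesis using True x(3) by simp
      qed (use z_supp in \<open>cases "j = j0"; simp\<close>)
    qed
    also have "\<dots> = x $ \<pi> j0 * ?z j0 ^ q" using S j0(1) by (auto simp: sum.delta)
    finally have "(\<Sum>j<n. x $ \<pi> j * ?z j ^ q) = x $ \<pi> j0 * ?z j0 ^ q" .
    then have "form x ?z = x $ \<pi> j0 * ?z j0 ^ q"
    proof -
      have "?z (n + k) = 0" for k using S by (intro z_supp) auto
      then show ?thesis using \<open>(\<Sum>j<n. x $ \<pi> j * ?z j ^ q) = x $ \<pi> j0 * ?z j0 ^ q\<close>
        by (simp add: form_split)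
    qed
    then have "form x ?z \<noteq> 0" using x(2) j0(2) by simp
    then show ?thesis using x(1) by blast
  next
    assume S: "S \<subseteq> {n..<n + c}"
    then obtain i where i: "j0 = n + i" "i < c" using j0(1) by (metis atLeastLessThan_iff le_Suc_ex nat_add_left_cancel_less subsetD)
    \<comment> \<open>On the receiver's positions the extension of \<open>e i\<close> has the single
      nonzero entry -1, at position \<open>i\<close>.\<close>
    have "(\<Sum>k<c. herm (e i) (e k) * ?z (n + k) ^ q) = (\<Sum>k<c. if k = i then - (?z j0 ^ q) else 0)"
      using orthonormal i by (intro sum.cong) (auto simp: anti_orthonormal_def)
    also have "\<dots> = - (?z j0 ^ q)" using i(2) by simp
    finally have "(\<Sum>k<c. herm (e i) (e k) * ?z (n + k) ^ q) = - (?z j0 ^ q)" .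
    moreover have "?z j = 0" if "j < n" for j using S that by (intro z_supp) auto
    ultimately have "form (e i) ?z = - (?z j0 ^ q)" by (simp add: form_split)
    moreover have "e i \<in> C" using orthonormal i(2) by (auto simp: anti_orthonormal_def)
    moreover have "- (?z j0 ^ q) \<noteq> 0" using j0(2) by simp
    ultimately show ?thesis by metis
  qed
  then show ?thesis using noncommuting ab by blast
qed

section \<open>Translation between qudit words and words over the subfield\<close>

abbreviation "B \<equiv> qwords q n \<times> qwords q c"

definition \<Phi> :: "nat list \<times> nat list \<Rightarrow> nat \<Rightarrow> 'a" where
  "\<Phi> x j = (if j < n then enc (fst x ! j) else if j < n + c then enc (snd x ! (j - n)) else 0)"

definition \<Psi> :: "(nat \<Rightarrow> 'a) \<Rightarrow> nat list \<times> nat list" where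
  "\<Psi> u = (map (\<lambda>j. inv_into {..<q} enc (u j)) [0..<n], map (\<lambda>j. inv_into {..<q} enc (u (n + j))) [0..<c])"

lemma qwords_nth: "v \<in> qwords q m \<Longrightarrow> j < m \<Longrightarrow> v ! j < q"
  by (auto simp: qwords_def dest!: nth_mem)

lemma enc_inj: "i < q \<Longrightarrow> j < q \<Longrightarrow> enc i = enc j \<longleftrightarrow> i = j"
  using enc by (auto simp: bij_betw_def inj_on_def)

lemma enc_in: "i < q \<Longrightarrow> enc i \<in> Fq"
  using enc by (auto simp: bij_betw_def)

lemma inv_enc: "i < q \<Longrightarrow> inv_into {..<q} enc (enc i) = i"
  using enc by (auto simp: bij_betw_def)

lemma dec: "t \<in> Fq \<Longrightarrow> inv_into {..<q} enc t < q" "t \<in> Fq \<Longrightarrow> enc (inv_into {..<q} enc t) = t"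
  using enc inv_into_into[of t enc "{..<q}"] f_inv_into_f[of t enc "{..<q}"] by (auto simp: bij_betw_def)

lemma \<Psi>_\<Phi>: "x \<in> B \<Longrightarrow> \<Psi> (\<Phi> x) = x"
proof -
  assume "x \<in> B"
  then obtain v y where x: "x = (v, y)" "v \<in> qwords q n" "y \<in> qwords q c" by auto
  have "map (\<lambda>j. inv_into {..<q} enc (\<Phi> x j)) [0..<n] = v"
    using x by (intro nth_equalityI) (auto simp: \<Phi>_def inv_enc qwords_nth, auto simp: qwords_def)
  moreover have "map (\<lambda>j. inv_into {..<q} enc (\<Phi> x (n + j))) [0..<c] = y"
    using x by (intro nth_equalityI) (auto simp: \<Phi>_def inv_enc qwords_nth, auto simp: qwords_def)
  ultimately show ?thesis by (simp add: \<Psi>_def x)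
qed

lemma bij_\<Phi>: "bij_betw \<Phi> B X"
proof (rule bij_betwI[where g = \<Psi>])
  show "\<Phi> \<in> B \<rightarrow> X" by (auto simp: \<Phi>_def wordspace_def enc_in qwords_nth)
  show "\<Psi> \<in> X \<rightarrow> B" by (auto simp: \<Psi>_def wordspace_def qwords_def dec)
  show "x \<in> B \<Longrightarrow> \<Psi> (\<Phi> x) = x" for x by (rule \<Psi>_\<Phi>)
  fix u assume u: "u \<in> X"
  have "\<Phi> (\<Psi> u) j = u j" for j
  proof -
    consider "j < n" | "n \<le> j" "j < n + c" | "n + c \<le> j" by linarith
    then show ?thesis
      using u by cases (auto simp: \<Phi>_def \<Psi>_def wordspace_def dec)
  qed
  then show "\<Phi> (\<Psi> u) = u" by blast
qed

lemma \<Phi>_in: "x \<in> B \<Longrightarrow> \<Phi> x \<in> X"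
  using bij_betwE[OF bij_\<Phi>] by blast

lemma card_X: "card X = q ^ (n + c)"
  using bij_betw_same_card[OF bij_\<Phi>] by (simp add: card_cartesian_product card_qwords power_add)

lemma \<Phi>_left: "x \<in> B \<Longrightarrow> y \<in> B \<Longrightarrow> j < n \<Longrightarrow> \<Phi> x j = \<Phi> y j \<longleftrightarrow> fst x ! j = fst y ! j"
  by (auto simp: \<Phi>_def enc_inj qwords_nth)

lemma \<Phi>_right: "x \<in> B \<Longrightarrow> y \<in> B \<Longrightarrow> j < c \<Longrightarrow> \<Phi> x (n + j) = \<Phi> y (n + j) \<longleftrightarrow> snd x ! j = snd y ! j"
  by (auto simp: \<Phi>_def enc_inj qwords_nth)

lemma left_eq_iff: "x \<in> B \<Longrightarrow> y \<in> B \<Longrightarrow> fst x = fst y \<longleftrightarrow> (\<forall>j<n. \<Phi> x j = \<Phi> y j)"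
proof -
  assume xy: "x \<in> B" "y \<in> B"
  then have "fst x = fst y \<longleftrightarrow> (\<forall>j<n. fst x ! j = fst y ! j)"
    by (auto simp: qwords_def list_eq_iff_nth_eq)
  then show ?thesis using \<Phi>_left[OF xy] by blast
qed

lemma right_eq_iff: "x \<in> B \<Longrightarrow> y \<in> B \<Longrightarrow> snd x = snd y \<longleftrightarrow> (\<forall>j\<in>{n..<n + c}. \<Phi> x j = \<Phi> y j)"
proof -
  assume xy: "x \<in> B" "y \<in> B"
  have "snd x = snd y \<longleftrightarrow> (\<forall>j<c. snd x ! j = snd y ! j)"
    using xy by (auto simp: qwords_def list_eq_iff_nth_eq)
  also have "\<dots> \<longleftrightarrow> (\<forall>j<c. \<Phi> x (n + j) = \<Phi> y (n + j))" using \<Phi>_right[OF xy] by blast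
  also have "\<dots> \<longleftrightarrow> (\<forall>j\<in>{n..<n + c}. \<Phi> x j = \<Phi> y j)"
    by (metis add_less_cancel_left atLeastLessThan_iff le_add1 le_Suc_ex)
  finally show ?thesis .
qed

definition proj :: "(nat list \<times> nat list, nat list \<times> nat list) op" where
  "proj x y = I.P (\<Phi> x) (\<Phi> y)"

lemma proj_eq: "proj = (\<lambda>x y. I.P (\<Phi> x) (\<Phi> y))"
  by (intro ext) (rule proj_def)

text \<open>Locality confines the Weyl labels of \<open>F\<close> to \<open>S\<close>, where nonzero
  ones fail to commute with the group. What survives is the identity coefficient, the normalised
  trace of \<open>F\<close>.\<close>

lemma sandwich:
  assumes F: "local_on (n + c) S (\<lambda>u v. F (\<Psi> u) (\<Psi> v))"
    and S: "S \<subseteq> {..<n} \<and> card S \<le> K \<or> S \<subseteq> {n..<n + c}"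
    and x: "x \<in> B" "x' \<in> B"
  shows "op_mult B (op_mult B proj F) proj x x' = (\<Sum>x\<in>B. F x x) / of_nat (q ^ (n + c)) * proj x x'"
proof -
  let ?F = "\<lambda>u v. F (\<Psi> u) (\<Psi> v)"
  have "op_mult B (op_mult B proj F) proj x x'
      = op_mult B (op_mult B proj (\<lambda>x y. ?F (\<Phi> x) (\<Phi> y))) proj x x'"
    by (intro op_mult_cong) (simp_all add: \<Psi>_\<Phi>)
  also have "\<dots> = op_mult X (op_mult X I.P ?F) I.P (\<Phi> x) (\<Phi> x')"
  proof -
    have "op_mult B proj (\<lambda>x y. ?F (\<Phi> x) (\<Phi> y)) = (\<lambda>x z. op_mult X I.P ?F (\<Phi> x) (\<Phi> z))"
      unfolding proj_eq by (intro ext op_mult_reindex[OF bij_\<Phi>, of I.P ?F])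
    then show ?thesis
      unfolding proj_eq using op_mult_reindex[OF bij_\<Phi>, of "op_mult X I.P ?F" I.P] by simp
  qed
  also have "\<dots> = W.coef ?F 0 * I.P (\<Phi> x) (\<Phi> x')"
  proof (rule I.knill_laflamme)
    show "\<Phi> x \<in> X" "\<Phi> x' \<in> X" using x by (auto intro: \<Phi>_in)
    fix ab assume ab: "ab \<in> X \<times> X" "ab \<noteq> 0" "W.coef ?F ab \<noteq> 0"
    obtain a b where "ab = (a, b)" by (cases ab)
    then show "\<exists>g\<in>coords_pair ` C. W.cocycle g ab \<noteq> W.cocycle ab g"
      using local_noncommuting[OF S, of a b] coef_local[OF F, of a b] ab by auto
  qed
  also have "W.coef ?F 0 = (\<Sum>x\<in>B. F x x) / of_nat (q ^ (n + c))"
  proof -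
    have "(\<Sum>u\<in>X. ?F u u) = (\<Sum>x\<in>B. ?F (\<Phi> x) (\<Phi> x))"
      using sum.reindex_bij_betw[OF bij_\<Phi>, of "\<lambda>u. ?F u u"] by simp
    also have "\<dots> = (\<Sum>x\<in>B. F x x)" by (intro sum.cong) (auto simp: \<Psi>_\<Phi>)
    finally show ?thesis by (simp add: W.coef_0 card_X)
  qed
  finally show ?thesis unfolding proj_eq .
qed

lemma \<Psi>_in: "u \<in> X \<Longrightarrow> \<Psi> u \<in> B" and \<Phi>_\<Psi>: "u \<in> X \<Longrightarrow> \<Phi> (\<Psi> u) = u"
proof -
  assume "u \<in> X"
  then obtain x where "x \<in> B" "u = \<Phi> x" using bij_betw_imp_surj_on[OF bij_\<Phi>] by blast
  then show "\<Psi> u \<in> B" "\<Phi> (\<Psi> u) = u" using \<Psi>_\<Phi> by auto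
qed

lemma local_sender:
  assumes E: "acts_on q n S E" and S: "S \<subseteq> {..<n}"
  shows "local_on (n + c) S (\<lambda>u v. op_tensor E op_id (\<Psi> u) (\<Psi> v))"
proof -
  obtain F where F: "\<And>v v'. v \<in> qwords q n \<Longrightarrow> v' \<in> qwords q n \<Longrightarrow>
      E v v' = F (nths v S) (nths v' S) * op_id (nths v (- S)) (nths v' (- S))"
    using E by (auto simp: acts_on_def)
  have nths_iff: "nths (fst x) A = nths (fst y) A \<longleftrightarrow> (\<forall>j\<in>A. j < n \<longrightarrow> \<Phi> x j = \<Phi> y j)"
    if "x \<in> B" "y \<in> B" for x y A
  proof -
    have len: "length (fst x) = n" "length (fst y) = n" using that by (auto simp: qwords_def)
    then show ?thesis using nths_eq_iff[of "fst x" "fst y" A] \<Phi>_left[OF that] by auto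
  qed
  have val: "op_tensor E op_id x y =
      (if \<forall>j\<in>{..<n + c} - S. \<Phi> x j = \<Phi> y j then F (nths (fst x) S) (nths (fst y) S) else 0)"
    if xy: "x \<in> B" "y \<in> B" for x y
  proof -
    have "op_tensor E op_id x y = (if nths (fst x) (- S) = nths (fst y) (- S) \<and> snd x = snd y
        then F (nths (fst x) S) (nths (fst y) S) else 0)"
      using xy F by (auto simp: op_tensor_def op_id_def)
    moreover have "nths (fst x) (- S) = nths (fst y) (- S) \<and> snd x = snd y \<longleftrightarrow>
        (\<forall>j\<in>{..<n + c} - S. \<Phi> x j = \<Phi> y j)"
      unfolding nths_iff[OF xy] right_eq_iff[OF xy]
    proof (intro iffI conjI ballI impI)
      fix j assume "(\<forall>j\<in>- S. j < n \<longrightarrow> \<Phi> x j = \<Phi> y j) \<and> (\<forall>j\<in>{n..<n + c}. \<Phi> x j = \<Phi> y j)"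
        "j \<in> {..<n + c} - S"
      then show "\<Phi> x j = \<Phi> y j" by (cases "j < n") auto
    qed (use S in auto)
    ultimately show ?thesis by simp
  qed
  show ?thesis
    unfolding local_on_def
  proof (intro exI[of _ "\<lambda>u v. F (nths (fst (\<Psi> u)) S) (nths (fst (\<Psi> v)) S)"] conjI ballI impI)
    fix u v assume uv: "u \<in> X" "v \<in> X"
    then show "op_tensor E op_id (\<Psi> u) (\<Psi> v) = (if \<forall>j\<in>{..<n + c} - S. u j = v j
        then F (nths (fst (\<Psi> u)) S) (nths (fst (\<Psi> v)) S) else 0)"
      using val[OF \<Psi>_in \<Psi>_in, of u v] by (simp add: \<Phi>_\<Psi>)
    fix u' v' assume uv': "u' \<in> X" "v' \<in> X" and eq: "\<forall>j\<in>S. u j = u' j \<and> v j = v' j"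
    then have "nths (fst (\<Psi> u)) S = nths (fst (\<Psi> u')) S" "nths (fst (\<Psi> v)) S = nths (fst (\<Psi> v')) S"
      using uv by (auto simp: nths_iff \<Psi>_in \<Phi>_\<Psi>)
    then show "F (nths (fst (\<Psi> u)) S) (nths (fst (\<Psi> v)) S)
        = F (nths (fst (\<Psi> u')) S) (nths (fst (\<Psi> v')) S)" by simp
  qed
qed

lemma local_receiver:
  "local_on (n + c) {n..<n + c} (\<lambda>u v. op_tensor op_id (unit_op y y') (\<Psi> u) (\<Psi> v))"
  unfolding local_on_def
proof (intro exI[of _ "\<lambda>u v. unit_op y y' (snd (\<Psi> u)) (snd (\<Psi> v))"] conjI ballI impI)
  fix u v assume uv: "u \<in> X" "v \<in> X"
  have "{..<n + c} - {n..<n + c} = {..<n}" by auto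
  then have "fst (\<Psi> u) = fst (\<Psi> v) \<longleftrightarrow> (\<forall>j\<in>{..<n + c} - {n..<n + c}. u j = v j)"
    using left_eq_iff[OF \<Psi>_in \<Psi>_in, of u v] uv by (simp add: \<Phi>_\<Psi> Ball_def)
  then show "op_tensor op_id (unit_op y y') (\<Psi> u) (\<Psi> v) =
      (if \<forall>j\<in>{..<n + c} - {n..<n + c}. u j = v j then unit_op y y' (snd (\<Psi> u)) (snd (\<Psi> v)) else 0)"
    by (auto simp: op_tensor_def op_id_def case_prod_unfold)
  fix u' v' assume uv': "u' \<in> X" "v' \<in> X" and eq: "\<forall>j\<in>{n..<n + c}. u j = u' j \<and> v j = v' j"
  then have "snd (\<Psi> u) = snd (\<Psi> u')" "snd (\<Psi> v) = snd (\<Psi> v')"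
    using uv right_eq_iff[OF \<Psi>_in \<Psi>_in] by (simp_all add: \<Phi>_\<Psi>)
  then show "unit_op y y' (snd (\<Psi> u)) (snd (\<Psi> v)) = unit_op y y' (snd (\<Psi> u')) (snd (\<Psi> v'))" by simp
qed

text \<open>The trace of the projector is q^(n+c) divided by the q^(2K) labels. Detecting fewer than
  K + 1 errors is exactly the reach of interpolation by the code.\<close>

lemma eaqecc_exists:
  assumes "2 * K \<le> n + c"
  shows "\<exists>Q. eaqecc q n (n + c - 2 * K) (K + 1) c Q"
proof (rule eaqecc_from_projector[where P = proj])
  show "q > 0" using q_gt_1 by simp
  show "\<forall>x\<in>B. \<forall>y\<in>B. proj x y = cnj (proj y x)"
    unfolding proj_def by (intro ballI I.P_herm \<Phi>_in)
  show "\<forall>x\<in>B. \<forall>y\<in>B. op_mult B proj proj x y = proj x y"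
    unfolding proj_eq op_mult_reindex[OF bij_\<Phi>, of I.P I.P] I.P_idem by simp
  have "card (coords_pair ` C) = q ^ (2 * K)"
    using card_image[OF inj_on_subset[OF coords_pair_inj subset_UNIV], of C] grs_code_card[OF grs]
    by (simp add: card_UNIV_eq power_mult)
  moreover have "(\<Sum>x\<in>B. proj x x) = (\<Sum>u\<in>X. I.P u u)"
    unfolding proj_def using sum.reindex_bij_betw[OF bij_\<Phi>, of "\<lambda>u. I.P u u"] .
  moreover have "q ^ (n + c) = q ^ (n + c - 2 * K) * q ^ (2 * K)"
    using assms by (simp flip: power_add)
  ultimately show "(\<Sum>x\<in>B. proj x x) = of_nat (q ^ (n + c - 2 * K))"
    using q_gt_1 by (simp add: I.P_trace card_X)
next
  fix y y' x x' assume y: "y \<in> qwords q c" "y' \<in> qwords q c" and x: "x \<in> B" "x' \<in> B"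
  let ?F = "op_tensor op_id (unit_op y y') :: (nat list \<times> nat list, nat list \<times> nat list) op"
  \<comment> \<open>The trace is q^n or 0; dividing by q^(n+c) gives the scalar of a maximally mixed
    receiver state.\<close>
  have "(\<Sum>x\<in>B. ?F x x) = (\<Sum>v\<in>qwords q n. \<Sum>z\<in>qwords q c. if z = y then if y = y' then 1 else 0 else 0)"
    unfolding sum.cartesian_product'
    by (intro sum.cong) (auto simp: op_tensor_def op_id_def unit_op_def)
  also have "\<dots> = (if y = y' then of_nat (q ^ n) else 0)"
    using y finite_qwords by (simp add: sum.delta card_qwords)
  finally have "(\<Sum>x\<in>B. ?F x x) / of_nat (q ^ (n + c)) = (if y = y' then 1 / of_nat (q ^ c) else 0)"
    using q_gt_1 by (simp add: power_add)
  then show "op_mult B (op_mult B proj ?F) proj x x'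
      = (if y = y' then 1 / of_nat (q ^ c) else 0) * proj x x'"
    using sandwich[OF local_receiver _ x, of y y'] by simp
next
  fix S E assume S: "S \<subseteq> {..<n}" "card S < K + 1" "acts_on q n S E"
  show "\<exists>z. \<forall>x\<in>B. \<forall>y\<in>B. op_mult B (op_mult B proj (op_tensor E op_id)) proj x y = z * proj x y"
  proof (intro exI ballI)
    fix x y assume "x \<in> B" "y \<in> B"
    then show "op_mult B (op_mult B proj (op_tensor E op_id)) proj x y
        = (\<Sum>x\<in>B. op_tensor E op_id x x) / of_nat (q ^ (n + c)) * proj x y"
      using S(1,2) by (intro sandwich[OF local_sender[OF S(3,1)]]) auto
  qed
qed

end

section \<open>From GRS codes with prescribed hull to the quantum codes\<close>

context quadratic_extension
begin

lemma grs_eaqecc_exists: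
  fixes C :: "('a ^ 'n::finite) set"
  assumes grs: "grs_code K C" and n: "CARD('n) = n" and hull: "vec.dim (hermitian_hull q C) = s"
    and Ks: "2 * K \<le> n"
  shows "\<exists>Q. eaqecc q n (n - K - s) (K + 1) (K - s) Q"
proof -
  have sub: "vec.subspace C" by (rule grs_code_subspace[OF grs])
  obtain c e where e: "anti_orthonormal C c e"
    "\<forall>x\<in>C. \<forall>y\<in>C. herm x y + (\<Sum>j<c. herm x (e j) * herm y (e j) ^ q) = 0"
    using maximal_anti_orthonormal[OF sub] by blast
  \<comment> \<open>Comparing sizes identifies the length of the system as c = K - s, the number of
    entangled pairs.\<close>
  have "CARD('a) ^ K = CARD('a) ^ s * CARD('a) ^ c"
    using card_hull_anti_orthonormal[OF sub e] grs_code_card[OF grs] hull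
      card_vec_subspace[OF hermitian_hull_subspace[OF sub]] by simp
  then have K: "K = s + c"
    using card_gt_1_field[where 'a='a] by (simp flip: power_add)
  obtain \<pi> where \<pi>: "bij_betw \<pi> {..<n} (UNIV :: 'n set)"
    using ex_bij_betw_nat_finite[of "UNIV :: 'n set"] n by (auto simp: atLeast0LessThan)
  obtain enc where enc: "bij_betw enc {..<q} Fq"
    using ex_bij_betw_nat_finite[of Fq] card_Fq by (auto simp: atLeast0LessThan)
  interpret extended_code q ty C K c n e \<pi> enc
    by unfold_locales (use grs e \<pi> enc in auto)
  have "n + c - 2 * K = n - K - s" "K - s = c" using K by auto
  then show ?thesis using eaqecc_exists Ks by simp
qed

end

theorem theorem7:
  fixes q n k l i s :: nat
  assumes "primepow q" and "q > 2"
    and "CARD('a::{field,finite}) = q ^ 2" and "CARD('n::finite) = n"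
    and "0 \<le> 2 * k" and "2 * k \<le> n" and "n \<le> q ^ 2"
    and "0 \<le> l" and "l \<le> k"
    and "\<exists>(C :: ('a ^ 'n) set) Q.
           grs_code k C \<and> vec.dim (hermitian_hull q C) = l \<and>
           hermitian_construction q C n (n - k - l) (k + 1) (k - l) \<and>
           mds_eaqecc q n (n - k - l) (k + 1) (k - l) Q"
    and "0 \<le> i" and "real i \<le> min (real l) (real n / 2 - real k)"
    and "0 \<le> s" and "s \<le> l - i"
  shows "\<exists>Q. mds_eaqecc q n (n - k - i - s) (k + i + 1) (k + i - s) Q"
proof -
  interpret quadratic_extension q "TYPE('a)"
    using assms(1,3) by unfold_locales
  have i: "i \<le> l" "2 * (k + i) \<le> n" using assms(12) by (auto simp: min_def split: if_splits)
  obtain C :: "('a ^ 'n) set" where C: "grs_code k C" "vec.dim (hermitian_hull q C) = l"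
    using assms(10) by blast
  obtain C' :: "('a ^ 'n) set" where C': "grs_code (k + i) C'" "l \<le> vec.dim (hermitian_hull q C') + i"
    using grs_hull_extend[OF C(1), of i] i C(2) assms(4) by auto
  \<comment> \<open>Raising the degree bound \<open>i\<close> times leaves a hull of dimension at
    least l - i, so \<open>s\<close> can be reached by reduction alone.\<close>
  have "s \<le> vec.dim (hermitian_hull q C')" using C'(2) assms(14) i(1) by linarith
  then obtain C'' :: "('a ^ 'n) set" where C'': "grs_code (k + i) C''" "vec.dim (hermitian_hull q C'') = s"
    using grs_hull_reduce[OF assms(2) C'(1)] by blast
  obtain Q where "eaqecc q n (n - (k + i) - s) (k + i + 1) (k + i - s) Q"
    using grs_eaqecc_exists[OF C''(1) assms(4) C''(2) i(2)] by blast
  moreover have "n - (k + i) - s = n - k - i - s" by simp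
  \<comment> \<open>No subtraction truncates here: s <= k + i and 2 (k + i) <= n.\<close>
  moreover have "n - k - i - s = k + i - s + (n + 2 - 2 * (k + i + 1))"
    using i assms(9,14) by simp
  ultimately show ?thesis using i(2) unfolding mds_eaqecc_def by (intro exI[of _ Q]) auto
qed

end
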